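(* Let $\alpha\ge0$, $L>0$ and $i\in\{1,2\}$. For any $u\in H^1_{w_i^{\alpha,L}}([0,\infty))$ there exists a constant $c>0$ such that, for all sufficiently large positive integers $n$, $$\|I_nu\|_{L^2_{w_i^{\alpha,L}}([0,\infty))}<c\left(\|u\|_{L^2_{w_i^{\alpha,L}}([0,\infty))}+\frac1n\left\|\sqrt{(t+1)\sqrt t}\;u'\right\|_{L^2([0,\infty))}\right).$$
   Context: For $\alpha>-1/2$, $G_k^{\alpha}$ denotes the degree-$k$ Gegenbauer polynomial, orthogonal on $[-1,1]$ with respect to $w^\alpha(x)=(1-x^2)^{\alpha-1/2}$ and normalized by $G_k^\alpha(1)=1$ (Chebyshev polynomials of the first kind for $\alpha=0$). Let $x_{n,0}^\alpha,\dots,x_{n,n}^\alpha$ be the zeros of $G_{n+1}^\alpha$. For $L>0$, $t\ge0$ set $T_{1,L}(t)=(t-L)/(t+L)$, $T_{2,L}(t)=1-2e^{-t/L}$, and for $i\in\{1,2\}$ put $\mathcal{G}_{i,k}^{\alpha,L}(t)=G_k^\alpha(T_{i,L}(t))$ and nodes ${}_i^Lt_{n,j}^\alpha=T_{i,L}^{-1}(x_{n,j}^\alpha)$, $j=0,\dots,n$. Weight functions on $[0,\infty)$: $w_1^{\alpha,L}(t)=\dfrac{4^\alpha L^{\alpha+1/2}t^{\alpha-1/2}}{(t+L)^{2\alpha+1}}$ and $w_2^{\alpha,L}(t)=\dfrac2L e^{-t/L}\left[1-(1-2e^{-t/L})^2\right]^{\alpha-1/2}$. For a weight $w$, $\|u\|_{L^2_w([0,\infty))}=\left(\int_0^\infty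 |u|^2w\,dt\right)^{1/2}$; $L^2([0,\infty))$ is the case $w=1$; and $H^1_w([0,\infty))=\{u:\ u,u'\in L^2_w([0,\infty))\}$. $I_nu$ denotes the interpolant: the unique function in $\mathrm{span}\{\mathcal{G}_{i,0}^{\alpha,L},\dots,\mathcal{G}_{i,n}^{\alpha,L}\}$ with $I_nu({}_i^Lt_{n,j}^\alpha)=u({}_i^Lt_{n,j}^\alpha)$ for $j=0,\dots,n$.
   Formalization: The function u is assumed not to be zero almost everywhere, because for u = 0 both sides vanish and the strict inequality fails. *)

theory Defs
  imports "HOL-Analysis.Analysis" "HOL-Computational_Algebra.Polynomial"
begin

definition gegenbauer_weight :: "real \<Rightarrow> real \<Rightarrow> real" where
  "gegenbauer_weight \<alpha> x = (1 - x\<^sup>2) powr (\<alpha> - 1/2)"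

(* Normalised by the value 1 at x = 1, so that \<alpha> = 0 gives the Chebyshev polynomials of the
   first kind. The description is meaningful for \<alpha> > -1/2. *)
definition gegenbauer :: "real \<Rightarrow> nat \<Rightarrow> real poly" where
  "gegenbauer \<alpha> = (THE G.
     (\<forall>k. degree (G k) = k \<and> poly (G k) 1 = 1) \<and>
     (\<forall>j k. j \<noteq> k \<longrightarrow>
        (LINT x:{-1..1}|lborel. poly (G j) x * poly (G k) x * gegenbauer_weight \<alpha> x) = 0))"

(* The index i is meant to range over {1, 2}: i = 1 is the rational map, i = 2 the exponential map. *)
definition map_T :: "nat \<Rightarrow> real \<Rightarrow> real \<Rightarrow> real" where
  "map_T i L t = (if i = 1 then (t - L) / (t + L) else 1 - 2 * exp (- t / L))"

definition mapped_gegenbauer :: "nat \<Rightarrow> real \<Rightarrow> real \<Rightarrow> nat \<Rightarrow> real \<Rightarrow> real" where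
  "mapped_gegenbauer i \<alpha> L k t = poly (gegenbauer \<alpha> k) (map_T i L t)"

definition mapped_nodes :: "nat \<Rightarrow> real \<Rightarrow> real \<Rightarrow> nat \<Rightarrow> real set" where
  "mapped_nodes i \<alpha> L n = inv_into {0..} (map_T i L) ` {x. poly (gegenbauer \<alpha> (n + 1)) x = 0}"

definition mapped_space :: "nat \<Rightarrow> real \<Rightarrow> real \<Rightarrow> nat \<Rightarrow> (real \<Rightarrow> real) set" where
  "mapped_space i \<alpha> L n =
     {v. \<exists>a :: nat \<Rightarrow> real. v = (\<lambda>t. \<Sum>k\<le>n. a k * mapped_gegenbauer i \<alpha> L k t)}"

definition interpolant ::
    "nat \<Rightarrow> real \<Rightarrow> real \<Rightarrow> nat \<Rightarrow> (real \<Rightarrow> real) \<Rightarrow> real \<Rightarrow> real" where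
  "interpolant i \<alpha> L n u =
     (THE v. v \<in> mapped_space i \<alpha> L n \<and> (\<forall>t \<in> mapped_nodes i \<alpha> L n. v t = u t))"

definition mapped_weight :: "nat \<Rightarrow> real \<Rightarrow> real \<Rightarrow> real \<Rightarrow> real" where
  "mapped_weight i \<alpha> L t =
     (if i = 1
      then 4 powr \<alpha> * L powr (\<alpha> + 1/2) * t powr (\<alpha> - 1/2) / (t + L) powr (2 * \<alpha> + 1)
      else 2 / L * exp (- t / L) * (1 - (1 - 2 * exp (- t / L))\<^sup>2) powr (\<alpha> - 1/2))"

(* The norm takes the value \<infinity> when the integral diverges; no integrability is presupposed. *)
definition wL2_norm :: "(real \<Rightarrow> real) \<Rightarrow> (real \<Rightarrow> real) \<Rightarrow> ennreal" where
  "wL2_norm w u =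
     (let J = (\<integral>\<^sup>+ t. ennreal (\<bar>u t\<bar>\<^sup>2 * w t) \<partial>lebesgue_on {0..})
      in if J = \<infinity> then \<infinity> else ennreal (sqrt (enn2real J)))"

definition wL2 :: "(real \<Rightarrow> real) \<Rightarrow> (real \<Rightarrow> real) set" where
  "wL2 w = {u. u \<in> borel_measurable (lebesgue_on {0..}) \<and> wL2_norm w u < \<infinity>}"

definition test_function_on :: "real set \<Rightarrow> (real \<Rightarrow> real) \<Rightarrow> bool" where
  "test_function_on S \<phi> \<longleftrightarrow>
     (\<forall>k x. (deriv ^^ k) \<phi> differentiable (at x)) \<and>
     (\<exists>K. compact K \<and> K \<subseteq> S \<and> (\<forall>x. x \<notin> K \<longrightarrow> \<phi> x = 0))"

definition locally_integrable_on :: "(real \<Rightarrow> real) \<Rightarrow> real set \<Rightarrow> bool" where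
  "locally_integrable_on f S \<longleftrightarrow>
     (\<forall>K. compact K \<and> K \<subseteq> S \<longrightarrow> f absolutely_integrable_on K)"

definition has_weak_derivative_on ::
    "(real \<Rightarrow> real) \<Rightarrow> (real \<Rightarrow> real) \<Rightarrow> real set \<Rightarrow> bool" where
  "has_weak_derivative_on u g S \<longleftrightarrow>
     locally_integrable_on u S \<and> locally_integrable_on g S \<and>
     (\<forall>\<phi>. test_function_on S \<phi> \<longrightarrow>
        (LINT t:S|lebesgue. u t * deriv \<phi> t) = - (LINT t:S|lebesgue. g t * \<phi> t))"

(* Derivatives are distributional on the open half-line. Elements are functions rather than
   classes modulo null sets, so statements about point values of u must select the
   representative that is continuous on the open half-line. *)
definition wH1 :: "(real \<Rightarrow> real) \<Rightarrow> (real \<Rightarrow> real) set" where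
  "wH1 w = {u. u \<in> wL2 w \<and> (\<exists>g. has_weak_derivative_on u g {0<..} \<and> g \<in> wL2 w)}"

end

theory Submission
  imports Defs
begin

text \<open>
  The constant may depend on \<open>u\<close>, and \<open>u\<close> is not almost everywhere zero, so its weighted norm is a fixed
  positive number. If the norm of \<open>sqrt ((t + 1) sqrt t) u'\<close> is infinite, the right-hand side is infinite
  while every interpolant has finite norm. Otherwise it suffices that the norms of the
  interpolants of \<open>u\<close> stay bounded as \<open>n\<close> grows, and this follows from two facts.

  First, \<open>u\<close> is bounded on the open half-line (\<open>bounded_of_weighted_weak_derivative\<close>). The reciprocal of
  \<open>(t + 1) sqrt t\<close> is integrable over the half-line, with integral \<open>\<pi>\<close>; so the weighted square integrability
  of \<open>u'\<close> makes \<open>u'\<close> integrable, and \<open>u\<close> has bounded oscillation. As \<open>u'\<close> is only a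
  distributional derivative, the oscillation is estimated by testing against smoothed indicators of
  intervals (\<open>oscillation_le_of_weak_derivative\<close>).

  Second, interpolation at Gauss nodes is stable with respect to the supremum over the nodes. The substitution
  \<open>x = map_T i L t\<close> turns the weighted norm on the half-line into the Gegenbauer norm on \<open>[-1, 1]\<close>
  (\<open>wL2_norm_poly_map_T\<close>) and the interpolant into the Lagrange interpolant \<open>p\<close> at the zeros of the
  Gegenbauer polynomial of degree \<open>n + 1\<close> (\<open>interpolant_eq_poly\<close>). The Lagrange basis at these nodes is
  orthogonal, so the squared norm of \<open>p\<close> is a sum of its squared nodal values with nonnegative weights
  whose total is the integral of the weight function; if \<open>\<bar>u\<bar> \<le> M\<close>, it is at most \<open>M\<^sup>2\<close> times that integral
  (\<open>E_square_le_of_bounded_on_nodes\<close>).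
\<close>

section \<open>Orthogonal polynomials and Gauss quadrature for a positive functional\<close>

text \<open>
  Gauss quadrature uses only that $p \mapsto \int p\, w$ is linear and strictly positive on nonzero
  polynomials that are nonnegative on the open interval. Isolating these properties keeps all
  measure theory out of the theory of orthogonal polynomials.
\<close>

locale positive_functional =
  fixes E :: "real poly \<Rightarrow> real" and a b :: real
  assumes E_add: "E (p + q) = E p + E q"
    and E_smult: "E (smult c p) = c * E p"
    and E_pos: "p \<noteq> 0 \<Longrightarrow> (\<And>x. a < x \<Longrightarrow> x < b \<Longrightarrow> poly p x \<ge> 0) \<Longrightarrow> E p > 0"
begin

lemma E_0 [simp]: "E 0 = 0"
  using E_smult[of 0 0] by simp

lemma E_minus: "E (- p) = - E p"
  using E_smult[of "-1" p] by simp

lemma E_diff: "E (p - q) = E p - E q"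
  using E_add[of p "- q"] E_minus[of q] by simp

lemma E_sum: "E (\<Sum>x\<in>A. f x) = (\<Sum>x\<in>A. E (f x))"
  by (induction A rule: infinite_finite_induct) (auto simp: E_add)

lemma E_square_pos: "p \<noteq> 0 \<Longrightarrow> E (p * p) > 0"
  by (rule E_pos) auto

definition orthogonal_below :: "nat \<Rightarrow> real poly \<Rightarrow> bool" where
  "orthogonal_below n P \<longleftrightarrow> degree P = n \<and> P \<noteq> 0 \<and> (\<forall>q. degree q < n \<longrightarrow> E (P * q) = 0)"

end

text \<open>
  Subtracting a multiple of the last basis polynomial lowers the degree, so one polynomial per degree
  spans. The alternative \<open>p = 0\<close> is what makes the empty family cover the zero polynomial, whose
  degree is \<open>0\<close> by convention.
\<close>

lemma poly_in_span_of_graded: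
  fixes f :: "nat \<Rightarrow> real poly"
  assumes "\<And>k. k < n \<Longrightarrow> degree (f k) = k \<and> f k \<noteq> 0" and "degree p < n \<or> p = 0"
  shows "\<exists>c. p = (\<Sum>k<n. smult (c k) (f k))"
  using assms
proof (induction n arbitrary: p)
  case 0
  then show ?case by auto
next
  case (Suc n)
  define d where "d = coeff p n / lead_coeff (f n)"
  define q where "q = p - smult d (f n)"
  have fn: "degree (f n) = n" "f n \<noteq> 0" using Suc.prems(1)[of n] by auto
  then have lc: "coeff (f n) n \<noteq> 0" by (metis leading_coeff_0_iff)
  have "degree p \<le> n" using Suc.prems(2) by auto
  then have dq: "degree q \<le> n" unfolding q_def using fn
    by (intro degree_diff_le) auto
  have "coeff q n = 0" unfolding q_def d_def using fn lc by simp
  then have "degree q < n \<or> q = 0"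
    using dq by (metis leading_coeff_0_iff le_neq_implies_less)
  moreover have "\<And>k. k < n \<Longrightarrow> degree (f k) = k \<and> f k \<noteq> 0" using Suc.prems(1) by auto
  ultimately obtain c where c: "q = (\<Sum>k<n. smult (c k) (f k))" using Suc.IH[of q] by blast
  have "p = (\<Sum>k<Suc n. smult ((c(n := d)) k) (f k))"
    using c by (simp add: q_def algebra_simps)
  then show ?case by blast
qed

context positive_functional
begin

text \<open>
  Gram-Schmidt: subtract from \<open>x^n\<close> its projections on the orthogonal polynomials of smaller degree.
\<close>

lemma ex_orthogonal_below: "\<exists>P. orthogonal_below n P"
proof (induction n rule: less_induct)
  case (less n)
  define f where "f k = (SOME P. orthogonal_below k P)" for k
  have f: "orthogonal_below k (f k)" if "k < n" for k
    unfolding f_def using less[OF that] by (rule someI_ex)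
  have f_orth: "E (f k * f j) = 0" if "k < n" "j < n" "j \<noteq> k" for j k
  proof (cases "j < k")
    case True
    then show ?thesis using f[of k] f[of j] that by (auto simp: orthogonal_below_def)
  next
    case False
    then have "E (f j * f k) = 0" using f[of k] f[of j] that by (auto simp: orthogonal_below_def)
    then show ?thesis by (simp add: mult.commute)
  qed
  define c where "c k = E (monom 1 n * f k) / E (f k * f k)" for k
  define R where "R = (\<Sum>k<n. smult (c k) (f k))"
  define P where "P = monom 1 n - R"
  have cR: "coeff R n = 0"
    unfolding R_def using f by (auto simp: coeff_sum orthogonal_below_def intro!: sum.neutral coeff_eq_0)
  have "degree R \<le> n"
    unfolding R_def using f by (intro degree_sum_le) (auto simp: orthogonal_below_def less_imp_le)
  then have "degree P \<le> n" unfolding P_def by (intro degree_diff_le) (auto simp: degree_monom_eq)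
  moreover have cP: "coeff P n = 1" using cR by (simp add: P_def)
  ultimately have degP: "degree P = n" by (metis le_degree le_antisym zero_neq_one)
  have Pf: "E (P * f j) = 0" if "j < n" for j
  proof -
    have "E (R * f j) = (\<Sum>k<n. c k * E (f k * f j))"
      unfolding R_def by (simp add: sum_distrib_right E_sum E_smult)
    also have "\<dots> = (\<Sum>k<n. if k = j then c j * E (f j * f j) else 0)"
      by (rule sum.cong) (use f_orth that in auto)
    also have "\<dots> = c j * E (f j * f j)" using that by simp
    also have "\<dots> = E (monom 1 n * f j)"
      using E_square_pos[of "f j"] f[OF that] by (simp add: c_def orthogonal_below_def)
    finally show ?thesis by (simp add: P_def left_diff_distrib E_diff)
  qed
  have "E (P * q) = 0" if q: "degree q < n" for q
  proof -
    obtain d where "q = (\<Sum>k<n. smult (d k) (f k))"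
      using poly_in_span_of_graded[of n f q] f q by (auto simp: orthogonal_below_def)
    then show ?thesis by (simp add: sum_distrib_left E_sum E_smult Pf)
  qed
  moreover have "P \<noteq> 0" using cP by auto
  ultimately show ?case using degP by (auto simp: orthogonal_below_def)
qed

lemma orthogonal_belowI_sequence:
  assumes "\<And>k. degree (G k) = k \<and> G k \<noteq> 0" and "\<And>j k. j \<noteq> k \<Longrightarrow> E (G j * G k) = 0"
  shows "orthogonal_below n (G n)"
  unfolding orthogonal_below_def
proof (intro conjI allI impI)
  fix q :: "real poly"
  assume "degree q < n"
  then obtain d where "q = (\<Sum>k<n. smult (d k) (G k))"
    using poly_in_span_of_graded[of n G q] assms(1) by auto
  then show "E (G n * q) = 0"
    by (simp add: sum_distrib_left E_sum E_smult assms(2))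
qed (use assms in auto)

text \<open>
  After matching leading coefficients the difference \<open>D\<close> has degree below \<open>n\<close>, hence is orthogonal to
  both polynomials and so to itself. The two are thus proportional, and the value at the right
  endpoint fixes the factor.
\<close>

lemma orthogonal_below_unique:
  assumes "orthogonal_below n P" "orthogonal_below n Q" "poly P b = 1" "poly Q b = 1"
  shows "P = Q"
proof -
  have lc: "coeff P n \<noteq> 0" "coeff Q n \<noteq> 0"
    using assms unfolding orthogonal_below_def by (metis leading_coeff_0_iff)+
  define r where "r = coeff P n / coeff Q n"
  define D where "D = P - smult r Q"
  have "degree D \<le> n" unfolding D_def
    using assms by (intro degree_diff_le) (auto simp: orthogonal_below_def)
  moreover have "coeff D n = 0" using lc by (simp add: D_def r_def)
  ultimately have D: "degree D < n \<or> D = 0"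
    by (metis leading_coeff_0_iff le_neq_implies_less)
  have "D = 0"
  proof (rule ccontr)
    assume "D \<noteq> 0"
    then have "E (P * D) = 0" "E (Q * D) = 0"
      using D assms by (auto simp: orthogonal_below_def)
    then have "E (D * D) = 0"
      by (subst (1) D_def) (simp add: left_diff_distrib E_diff E_smult)
    then show False using E_square_pos[OF \<open>D \<noteq> 0\<close>] by simp
  qed
  then have PQ: "P = smult r Q" by (simp add: D_def)
  with assms have "r = 1" by simp
  with PQ show ?thesis by simp
qed

end

lemma poly_nonvanishing_constant_sign:
  fixes p :: "real poly"
  assumes "\<And>x. a < x \<Longrightarrow> x < b \<Longrightarrow> poly p x \<noteq> 0"
  shows "(\<forall>x. a < x \<and> x < b \<longrightarrow> poly p x \<ge> 0) \<or> (\<forall>x. a < x \<and> x < b \<longrightarrow> poly p x \<le> 0)"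
proof (rule ccontr)
  assume "\<not> ?thesis"
  then obtain x y where xy: "a < x" "x < b" "a < y" "y < b" "poly p x < 0" "poly p y > 0"
    by (auto simp: not_le)
  then have "x \<noteq> y" by auto
  then consider "x < y" | "y < x" by linarith
  then show False
  proof cases
    case 1
    then show False using poly_IVT_pos[of x y p] xy assms by (meson less_trans)
  next
    case 2
    then show False using poly_IVT_neg[of y x p] xy assms by (meson less_trans)
  qed
qed

text \<open>
  The multiplier collects the roots of odd multiplicity in the interval. The induction never speaks of
  multiplicities: splitting off one root toggles its membership in the set, because a second
  factor contributes a square.
\<close>

lemma ex_sign_correcting_roots:
  fixes p :: "real poly"
  assumes "p \<noteq> 0"
  shows "\<exists>Z \<subseteq> {x. a < x \<and> x < b \<and> poly p x = 0}. finite Z \<and>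
     ((\<forall>x. a < x \<and> x < b \<longrightarrow> poly (p * (\<Prod>z\<in>Z. [:-z, 1:])) x \<ge> 0) \<or>
      (\<forall>x. a < x \<and> x < b \<longrightarrow> poly (p * (\<Prod>z\<in>Z. [:-z, 1:])) x \<le> 0))"
  using assms
proof (induction "degree p" arbitrary: p rule: less_induct)
  case less
  show ?case
  proof (cases "\<exists>z. a < z \<and> z < b \<and> poly p z = 0")
    case False
    then show ?thesis using poly_nonvanishing_constant_sign[of a b p]
      by (intro exI[of _ "{}"]) auto
  next
    case True
    then obtain z where z: "a < z" "z < b" "poly p z = 0" by blast
    then obtain q where q: "p = [:-z, 1:] * q" by (metis poly_eq_0_iff_dvd dvdE)
    with less.prems have "q \<noteq> 0" by auto
    then have "degree q < degree p" unfolding q by (subst degree_mult_eq) auto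
    then obtain Z where Z: "Z \<subseteq> {x. a < x \<and> x < b \<and> poly q x = 0}" "finite Z"
      and sgn: "(\<forall>x. a < x \<and> x < b \<longrightarrow> poly (q * (\<Prod>z\<in>Z. [:-z, 1:])) x \<ge> 0) \<or>
      (\<forall>x. a < x \<and> x < b \<longrightarrow> poly (q * (\<Prod>z\<in>Z. [:-z, 1:])) x \<le> 0)"
      using less.hyps[of q] \<open>q \<noteq> 0\<close> by blast
    have sub: "Z \<subseteq> {x. a < x \<and> x < b \<and> poly p x = 0}" using Z by (auto simp: q)
    show ?thesis
    proof (cases "z \<in> Z")
      case True
      have "(\<Prod>z\<in>Z. [:-z, 1:]) = [:-z, 1:] * (\<Prod>z\<in>Z - {z}. [:-z, 1:])"
        using True Z by (simp add: prod.remove)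
      then have "p * (\<Prod>z\<in>Z - {z}. [:-z, 1:]) = q * (\<Prod>z\<in>Z. [:-z, 1:])"
        unfolding q by (simp only: ac_simps)
      then show ?thesis using sgn sub Z by (intro exI[of _ "Z - {z}"]) auto
    next
      case False
      have "poly (p * (\<Prod>z\<in>insert z Z. [:-z, 1:])) x
          = (x - z)\<^sup>2 * poly (q * (\<Prod>z\<in>Z. [:-z, 1:])) x" for x
        using False Z by (simp add: q power2_eq_square algebra_simps)
      then show ?thesis using sgn sub Z z
        by (intro exI[of _ "insert z Z"]) (auto simp: mult_le_0_iff)
    qed
  qed
qed

lemma degree_prod_linear:
  fixes Z :: "real set"
  shows "finite Z \<Longrightarrow> degree (\<Prod>z\<in>Z. [:-z, 1:]) = card Z"
  by (subst degree_prod_eq_sum_degree) auto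

context positive_functional
begin

text \<open>
  If fewer than \<open>n\<close> roots corrected the sign of \<open>P\<close>, the correcting multiplier would have degree below
  \<open>n\<close> and be orthogonal to \<open>P\<close>; but its product with \<open>P\<close> has constant sign, so the functional cannot
  vanish on it.
\<close>

lemma orthogonal_below_roots:
  assumes P: "orthogonal_below n P"
  shows "finite {x. poly P x = 0}" "card {x. poly P x = 0} = n" "{x. poly P x = 0} \<subseteq> {a<..<b}"
proof -
  have P0: "P \<noteq> 0" "degree P = n" using P by (auto simp: orthogonal_below_def)
  show fin: "finite {x. poly P x = 0}" using P0 by (simp add: poly_roots_finite)
  obtain Z where Z: "Z \<subseteq> {x. a < x \<and> x < b \<and> poly P x = 0}" "finite Z"
      and sgn: "(\<forall>x. a < x \<and> x < b \<longrightarrow> poly (P * (\<Prod>z\<in>Z. [:-z, 1:])) x \<ge> 0) \<or>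
      (\<forall>x. a < x \<and> x < b \<longrightarrow> poly (P * (\<Prod>z\<in>Z. [:-z, 1:])) x \<le> 0)"
    using ex_sign_correcting_roots[of P a b] P0 by blast
  define Q where "Q = (\<Prod>z\<in>Z. [:-z, 1:])"
  have Q0: "Q \<noteq> 0" unfolding Q_def using Z by (auto simp: prod_zero_iff)
  have "E (P * Q) \<noteq> 0"
  proof (cases "\<forall>x. a < x \<and> x < b \<longrightarrow> poly (P * Q) x \<ge> 0")
    case True
    then have "E (P * Q) > 0" using P0 Q0 by (intro E_pos) auto
    then show ?thesis by simp
  next
    case False
    with sgn have "\<forall>x. a < x \<and> x < b \<longrightarrow> poly (- (P * Q)) x \<ge> 0" by (auto simp: Q_def)
    then have "E (- (P * Q)) > 0" using P0 Q0 by (intro E_pos) auto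
    then show ?thesis by (simp add: E_minus)
  qed
  then have "\<not> degree Q < n" using P by (auto simp: orthogonal_below_def)
  then have "n \<le> card Z" using Z by (simp add: Q_def degree_prod_linear)
  moreover have "Z \<subseteq> {x. poly P x = 0}" using Z by auto
  moreover have "card {x. poly P x = 0} \<le> n"
    using P0 card_poly_roots_bound by blast
  ultimately have eq: "Z = {x. poly P x = 0}"
    by (intro card_seteq) (use fin in auto)
  show "card {x. poly P x = 0} = n"
    using eq \<open>n \<le> card Z\<close> \<open>card {x. poly P x = 0} \<le> n\<close> by simp
  show "{x. poly P x = 0} \<subseteq> {a<..<b}" using Z eq by auto
qed

end

definition lagrange_basis :: "real set \<Rightarrow> real \<Rightarrow> real poly" where
  "lagrange_basis X x = smult (1 / (\<Prod>y\<in>X - {x}. x - y)) (\<Prod>y\<in>X - {x}. [:-y, 1:])"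

lemma poly_lagrange_basis:
  assumes "finite X" "x \<in> X" "y \<in> X"
  shows "poly (lagrange_basis X x) y = (if y = x then 1 else 0)"
  using assms by (auto simp: lagrange_basis_def poly_prod prod_zero_iff)

lemma degree_lagrange_basis:
  assumes "finite X" "x \<in> X"
  shows "degree (lagrange_basis X x) < card X"
proof -
  have "degree (lagrange_basis X x) \<le> card (X - {x})"
    unfolding lagrange_basis_def using assms
    by (metis degree_smult_le degree_prod_linear finite_Diff)
  then show ?thesis using assms by (metis card_Diff1_less le_less_trans)
qed

lemma poly_eqI_on_nodes:
  fixes p q :: "real poly"
  assumes "finite X" "degree p < card X" "degree q < card X" "\<And>x. x \<in> X \<Longrightarrow> poly p x = poly q x"
  shows "p = q"
proof (rule ccontr)
  assume "p \<noteq> q"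
  then have "card {x. poly (p - q) x = 0} \<le> degree (p - q)" "finite {x. poly (p - q) x = 0}"
    using card_poly_roots_bound[of "p - q"] poly_roots_finite[of "p - q"] by auto
  moreover have "X \<subseteq> {x. poly (p - q) x = 0}" using assms by auto
  moreover have "degree (p - q) < card X" using assms degree_diff_less by blast
  ultimately show False by (meson card_mono leD le_trans order_le_less_trans)
qed

lemma degree_lagrange_interpolation:
  assumes "finite X" "X \<noteq> {}"
  shows "degree (\<Sum>x\<in>X. smult (f x) (lagrange_basis X x)) < card X"
proof -
  have "degree (\<Sum>x\<in>X. smult (f x) (lagrange_basis X x)) \<le> card X - 1"
    using assms degree_lagrange_basis[of X]
    by (intro degree_sum_le) (fastforce intro: order_trans[OF degree_smult_le])+
  moreover have "card X > 0" using assms by (simp add: card_gt_0_iff)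
  ultimately show ?thesis by linarith
qed

lemma poly_lagrange_interpolation:
  assumes "finite X" "y \<in> X"
  shows "poly (\<Sum>x\<in>X. smult (f x) (lagrange_basis X x)) y = f y"
proof -
  have "poly (\<Sum>x\<in>X. smult (f x) (lagrange_basis X x)) y = (\<Sum>x\<in>X. if x = y then f y else 0)"
    unfolding poly_sum by (rule sum.cong) (use assms in \<open>auto simp: poly_lagrange_basis\<close>)
  then show ?thesis using assms by simp
qed

lemma lagrange_expansion:
  assumes "finite X" "degree p < card X"
  shows "p = (\<Sum>x\<in>X. smult (poly p x) (lagrange_basis X x))"
  using assms degree_lagrange_interpolation[of X "poly p"]
  by (cases "X = {}"; intro poly_eqI_on_nodes[of X]) (auto simp: poly_lagrange_interpolation)

context positive_functional
begin

text \<open>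
  A product of two different Lagrange polynomials vanishes at all nodes, so it is \<open>P\<close> times a polynomial
  of degree below \<open>n\<close>. This is the exactness of Gauss quadrature in the only form needed here.
\<close>

lemma lagrange_basis_orthogonal:
  assumes P: "orthogonal_below n P" and X: "X = {x. poly P x = 0}"
    and xy: "x \<in> X" "y \<in> X" "x \<noteq> y"
  shows "E (lagrange_basis X x * lagrange_basis X y) = 0"
proof -
  have fin: "finite X" and card: "card X = n"
    using orthogonal_below_roots[OF P] X by auto
  have degP: "degree P = n" "P \<noteq> 0" using P by (auto simp: orthogonal_below_def)
  let ?N = "\<Prod>z\<in>X. [:-z, 1:] :: real poly"
  let ?M = "\<Prod>z\<in>X - {x} - {y}. [:-z, 1:] :: real poly"
  \<comment> \<open>the difference has degree below \<open>n\<close> and vanishes at all \<open>n\<close> nodes\<close>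
  have PN: "P = smult (coeff P n) ?N"
  proof -
    define D where "D = P - smult (coeff P n) ?N"
    have dN: "degree ?N = n" using fin card by (simp add: degree_prod_linear)
    have "lead_coeff ?N = 1" by (simp add: lead_coeff_prod)
    then have c: "coeff D n = 0" using dN by (simp add: D_def)
    have "degree D \<le> n" unfolding D_def using dN degP
      by (intro degree_diff_le) auto
    with c have "degree D < n \<or> D = 0" by (metis leading_coeff_0_iff le_neq_implies_less)
    moreover have "poly D z = poly 0 z" if "z \<in> X" for z
      using that fin X by (auto simp: D_def poly_prod prod_zero_iff)
    ultimately have "D = 0" using fin card by (metis poly_eqI_on_nodes degree_0 not_less_zero gr0I)
    then show ?thesis by (simp add: D_def)
  qed
  have "coeff P n \<noteq> 0" using degP by auto
  then have NP: "?N = smult (1 / coeff P n) P" by (subst (2) PN) simp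
  have r: "X - {y} - {x} = X - {x} - {y}" by auto
  have 1: "(\<Prod>z\<in>X - {x}. [:-z, 1:]) = [:-y, 1:] * ?M"
    using fin xy by (intro prod.remove) auto
  have 2: "(\<Prod>z\<in>X - {y}. [:-z, 1:]) = [:-x, 1:] * ?M"
    using prod.remove[of "X - {y}" x "\<lambda>z. [:-z, 1:]"] fin xy by (simp add: r)
  have 3: "?N = [:-x, 1:] * ([:-y, 1:] * ?M)"
    using fin xy 1 by (subst prod.remove[of X x]) auto
  have "(\<Prod>z\<in>X - {x}. [:-z, 1:]) * (\<Prod>z\<in>X - {y}. [:-z, 1:]) = ?N * ?M"
    unfolding 1 2 3 by (simp only: ac_simps)
  then have "lagrange_basis X x * lagrange_basis X y
      = smult (1 / (\<Prod>z\<in>X - {x}. x - z) * (1 / (\<Prod>z\<in>X - {y}. y - z))) (?N * ?M)"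
    unfolding lagrange_basis_def mult_smult_left mult_smult_right smult_smult by (simp add: mult.commute)
  moreover have "degree ?M < n"
  proof -
    have "degree ?M = card (X - {x} - {y})" using fin by (simp add: degree_prod_linear)
    also have "\<dots> < card X" using fin xy by (intro psubset_card_mono) auto
    finally show ?thesis using card by simp
  qed
  then have "E (P * ?M) = 0" using P by (simp add: orthogonal_below_def)
  ultimately show ?thesis unfolding NP by (simp add: E_smult)
qed

lemma E_square_eq_gauss_sum:
  assumes P: "orthogonal_below n P" and X: "X = {x. poly P x = 0}" and p: "degree p < n"
  shows "E (p * p) = (\<Sum>x\<in>X. (poly p x)\<^sup>2 * E (lagrange_basis X x * lagrange_basis X x))"
proof -
  let ?l = "lagrange_basis X"
  have fin: "finite X" and card: "card X = n"
    using orthogonal_below_roots[OF P] X by auto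
  have e: "p = (\<Sum>x\<in>X. smult (poly p x) (?l x))"
    using lagrange_expansion[of X p] fin card p by simp
  have "E (p * p) = E ((\<Sum>x\<in>X. smult (poly p x) (?l x)) * (\<Sum>y\<in>X. smult (poly p y) (?l y)))"
    using e by simp
  also have "\<dots> = (\<Sum>x\<in>X. \<Sum>y\<in>X. poly p y * poly p x * E (?l x * ?l y))"
    by (simp add: sum_product E_sum E_smult)
  also have "\<dots> = (\<Sum>x\<in>X. \<Sum>y\<in>X. if y = x then (poly p x)\<^sup>2 * E (?l x * ?l x) else 0)"
    using lagrange_basis_orthogonal[OF P X]
    by (intro sum.cong) (auto simp: power2_eq_square)
  also have "\<dots> = (\<Sum>x\<in>X. (poly p x)\<^sup>2 * E (?l x * ?l x))" using fin by simp
  finally show ?thesis .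
qed

text \<open>
  The numbers \<open>E (l\<^sub>x * l\<^sub>x)\<close> are the Gauss weights: they are nonnegative, and they add up to \<open>E 1\<close> by the
  quadrature formula for the constant \<open>1\<close>.
\<close>

lemma E_square_le_of_bounded_on_nodes:
  assumes P: "orthogonal_below n P" and p: "degree p < n"
    and M: "\<And>x. poly P x = 0 \<Longrightarrow> \<bar>poly p x\<bar> \<le> M"
  shows "E (p * p) \<le> M\<^sup>2 * E 1"
proof -
  define X where "X = {x. poly P x = 0}"
  let ?e = "\<lambda>x. E (lagrange_basis X x * lagrange_basis X x)"
  have e0: "?e x \<ge> 0" for x
    using E_square_pos[of "lagrange_basis X x"] by (cases "lagrange_basis X x = 0") auto
  have "E 1 = (\<Sum>x\<in>X. ?e x)"
    using E_square_eq_gauss_sum[OF P X_def, of 1] p by simp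
  moreover have "E (p * p) = (\<Sum>x\<in>X. (poly p x)\<^sup>2 * ?e x)"
    by (rule E_square_eq_gauss_sum[OF P X_def p])
  moreover have "(\<Sum>x\<in>X. (poly p x)\<^sup>2 * ?e x) \<le> (\<Sum>x\<in>X. M\<^sup>2 * ?e x)"
    using e0 M by (intro sum_mono mult_right_mono) (auto simp: X_def abs_le_square_iff[symmetric]
        intro: order_trans[OF M abs_ge_self])
  ultimately show ?thesis by (simp add: sum_distrib_left)
qed

end

section \<open>Smooth test functions\<close>

text \<open>
  Smoothness is counted down one derivative at a time, so that closure under products can be shown by
  induction on the number of derivatives.
\<close>

definition diff_upto :: "nat \<Rightarrow> (real \<Rightarrow> real) \<Rightarrow> bool" where
  "diff_upto n f \<longleftrightarrow> (\<forall>k<n. \<forall>x. (deriv ^^ k) f differentiable (at x))"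

lemma diff_upto_0 [simp]: "diff_upto 0 f"
  by (simp add: diff_upto_def)

lemma diff_upto_Suc:
  "diff_upto (Suc n) f \<longleftrightarrow> (\<forall>x. f differentiable (at x)) \<and> diff_upto n (deriv f)"
  unfolding diff_upto_def by (simp add: All_less_Suc2 funpow_swap1)

lemma diff_upto_SucI:
  assumes "\<And>x. (f has_real_derivative f' x) (at x)" "diff_upto n f'"
  shows "diff_upto (Suc n) f"
proof -
  have "deriv f = f'" using assms(1) by (intro ext DERIV_imp_deriv)
  then show ?thesis using assms by (auto simp: diff_upto_Suc real_differentiable_def)
qed

lemma diff_upto_SucD:
  assumes "diff_upto (Suc n) f"
  shows "(f has_real_derivative deriv f x) (at x)" "diff_upto n (deriv f)"
  using assms by (auto simp: diff_upto_Suc real_differentiable_def intro: DERIV_deriv_iff_real_differentiable[THEN iffD2])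

lemma diff_upto_Suc_imp: "diff_upto (Suc n) f \<Longrightarrow> diff_upto n f"
  by (auto simp: diff_upto_def)

lemma diff_upto_affine_comb:
  assumes "diff_upto n f" "diff_upto n g"
  shows "diff_upto n (\<lambda>x. c * f (r * x + s) + d * g (r' * x + s'))"
  using assms
proof (induction n arbitrary: f g c d)
  case (Suc n)
  note D = diff_upto_SucD[OF Suc.prems(1)] diff_upto_SucD[OF Suc.prems(2)]
  show ?case
  proof (rule diff_upto_SucI)
    fix x
    show "((\<lambda>x. c * f (r * x + s) + d * g (r' * x + s')) has_real_derivative
        (c * r) * deriv f (r * x + s) + (d * r') * deriv g (r' * x + s')) (at x)"
      by (auto intro!: derivative_eq_intros DERIV_chain2[OF D(1)] DERIV_chain2[OF D(3)])
  qed (rule Suc.IH[OF D(2) D(4)])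
qed auto

lemma diff_upto_mult:
  assumes "diff_upto n f" "diff_upto n g"
  shows "diff_upto n (\<lambda>x. f x * g x)"
  using assms
proof (induction n arbitrary: f g)
  case (Suc n)
  note D = diff_upto_SucD[OF Suc.prems(1)] diff_upto_SucD[OF Suc.prems(2)]
  show ?case
  proof (rule diff_upto_SucI)
    fix x
    show "((\<lambda>x. f x * g x) has_real_derivative deriv f x * g x + f x * deriv g x) (at x)"
      by (auto intro!: derivative_eq_intros D(1) D(3))
  next
    have "diff_upto n (\<lambda>x. deriv f x * g x)" "diff_upto n (\<lambda>x. f x * deriv g x)"
      using Suc.IH[OF D(2) diff_upto_Suc_imp[OF Suc.prems(2)]]
        Suc.IH[OF diff_upto_Suc_imp[OF Suc.prems(1)] D(4)] .
    from diff_upto_affine_comb[OF this, of 1 1 0 1 1 0]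
    show "diff_upto n (\<lambda>x. deriv f x * g x + f x * deriv g x)" by simp
  qed
qed auto

text \<open>
  The functions \<open>p (1/x) exp (-1/x)\<close>, extended by \<open>0\<close>, form a family closed under differentiation that
  contains the classical flat function (\<open>p = 1\<close>); hence all of its members are smooth.
\<close>

definition flat_exp :: "real poly \<Rightarrow> real \<Rightarrow> real" where
  "flat_exp p x = (if x > 0 then poly p (1 / x) * exp (- (1 / x)) else 0)"

lemma power_poly_exp_tendsto_0: "((\<lambda>y::real. y ^ k * poly p y * exp (- y)) \<longlongrightarrow> 0) at_top"
proof (induction p arbitrary: k)
  case (pCons a p)
  have "((\<lambda>y. a * (y ^ k / exp y) + y ^ Suc k * poly p y * exp (- y)) \<longlongrightarrow> a * 0 + 0) at_top"
    by (intro tendsto_intros tendsto_power_div_exp_0 pCons)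
  then show ?case by (simp add: algebra_simps exp_minus divide_inverse)
qed auto

lemma flat_exp_at_0: "((\<lambda>h. flat_exp p h / h) \<longlongrightarrow> 0) (at 0)"
proof -
  have "((\<lambda>h. (1 / h) ^ 1 * poly p (1 / h) * exp (- (1 / h))) \<longlongrightarrow> 0) (at_right 0)"
    by (rule filterlim_compose[OF power_poly_exp_tendsto_0])
       (simp add: filterlim_inverse_at_top_right flip: inverse_eq_divide)
  then have "((\<lambda>h. flat_exp p h / h) \<longlongrightarrow> 0) (at_right 0)"
    by (rule Lim_transform_eventually)
       (auto simp: flat_exp_def eventually_at_filter)
  moreover have "((\<lambda>h. flat_exp p h / h) \<longlongrightarrow> 0) (at_left 0)"
    by (rule Lim_transform_eventually[of "\<lambda>_. 0"])
       (auto simp: flat_exp_def eventually_at_filter)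
  ultimately show ?thesis by (simp add: filterlim_split_at)
qed

lemma DERIV_flat_exp:
  "(flat_exp p has_real_derivative flat_exp (monom 1 2 * (p - pderiv p)) x) (at x)"
proof -
  consider "x > 0" | "x < 0" | "x = 0" by linarith
  then show ?thesis
  proof cases
    case 1
    have "((\<lambda>x. poly p (1 / x) * exp (- (1 / x))) has_real_derivative
        flat_exp (monom 1 2 * (p - pderiv p)) x) (at x)"
      using 1 by (auto intro!: derivative_eq_intros DERIV_chain2[OF poly_DERIV]
          simp: flat_exp_def poly_monom field_simps power2_eq_square)
    then show ?thesis
      by (rule has_field_derivative_transform_within[OF _ 1]) (auto simp: flat_exp_def dist_real_def)
  next
    case 2
    then have e: "flat_exp (monom 1 2 * (p - pderiv p)) x = 0" by (simp add: flat_exp_def)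
    have "((\<lambda>_. 0::real) has_real_derivative flat_exp (monom 1 2 * (p - pderiv p)) x) (at x)"
      unfolding e by simp
    then show ?thesis
      by (rule has_field_derivative_transform_within[where d = "-x"]) (use 2 in \<open>auto simp: flat_exp_def dist_real_def\<close>)
  next
    case 3
    then show ?thesis using flat_exp_at_0[of p]
      by (simp add: DERIV_def) (simp add: flat_exp_def)
  qed
qed

lemma diff_upto_flat_exp: "diff_upto n (flat_exp p)"
proof (induction n arbitrary: p)
  case (Suc n)
  then show ?case using DERIV_flat_exp by (rule_tac diff_upto_SucI)
qed auto

text \<open>
  The step is the normalised antiderivative of the bump \<open>exp (-1/x) exp (-1/(1-x))\<close> supported on the unit interval.
\<close>

lemma obtain_smooth_step:
  obtains B b :: "real \<Rightarrow> real"
  where "\<And>n. diff_upto n B" "\<And>x. (B has_real_derivative b x) (at x)"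
    "\<And>x. 0 \<le> b x" "\<And>x. x \<notin> {0..1} \<Longrightarrow> b x = 0"
    "\<And>x. x \<le> 0 \<Longrightarrow> B x = 0" "\<And>x. x \<ge> 1 \<Longrightarrow> B x = 1"
proof -
  define \<beta> where "\<beta> x = flat_exp 1 x * flat_exp 1 (1 - x)" for x
  have 0: "diff_upto n (\<lambda>x. flat_exp 1 (1 - x))" for n
    using diff_upto_affine_comb[OF diff_upto_flat_exp[of n 1] diff_upto_flat_exp[of n 1],
        where c = 1 and r = "-1" and s = 1 and d = 0]
    by simp
  have sm: "diff_upto n \<beta>" for n
    unfolding \<beta>_def by (intro diff_upto_mult diff_upto_flat_exp 0)
  have cont: "isCont \<beta> x" for x
    using sm[of 1] by (auto simp: diff_upto_Suc differentiable_imp_continuous_within)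
  obtain F where F: "\<And>x. (F has_real_derivative \<beta> x) (at x)"
    using einterval_antiderivative[of "-\<infinity>" "\<infinity>" \<beta>] cont
    by (auto simp: has_real_derivative_iff_has_vector_derivative)
  have nn: "\<beta> x \<ge> 0" and z: "x \<notin> {0<..<1} \<Longrightarrow> \<beta> x = 0"
    and pos: "0 < x \<Longrightarrow> x < 1 \<Longrightarrow> \<beta> x > 0" for x
    by (auto simp: \<beta>_def flat_exp_def)
  have contF: "continuous_on S F" for S
    by (rule DERIV_continuous_on) (rule has_field_derivative_at_within[OF F])
  have F0: "F x = F 0" if "x \<le> 0" for x
  proof (cases "x = 0")
    case False
    have "DERIV F y :> 0" if "x < y" "y < 0" for y using F[of y] z[of y] that by simp
    then show ?thesis using DERIV_isconst_end[of x 0 F] contF False that by simp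
  qed simp
  have F1: "F x = F 1" if "x \<ge> 1" for x
  proof (cases "x = 1")
    case False
    have "DERIV F y :> 0" if "1 < y" "y < x" for y using F[of y] z[of y] that by simp
    then show ?thesis using DERIV_isconst_end[of 1 x F] contF False that by simp
  qed simp
  have lt: "F 0 < F 1"
  proof (rule DERIV_pos_imp_increasing_open[of 0 1 F])
    show "\<exists>y. (F has_real_derivative y) (at x) \<and> 0 < y" if "0 < x" "x < 1" for x
      using F pos that by blast
  qed (simp_all add: contF)
  define B where "B x = 1 / (F 1 - F 0) * F x + (- F 0 / (F 1 - F 0))" for x
  define b where "b x = 1 / (F 1 - F 0) * \<beta> x" for x
  have dB: "(B has_real_derivative b x) (at x)" for x
    unfolding B_def b_def using F[of x] lt by (auto intro!: derivative_eq_intros)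
  have smb: "diff_upto n b" for n
    using diff_upto_affine_comb[OF sm sm, of n "1 / (F 1 - F 0)" 1 0 0 1 0] by (simp add: b_def[abs_def])
  show ?thesis
  proof (rule that[of B b])
    show "diff_upto n B" for n
      using diff_upto_SucI[OF dB smb] by (rule diff_upto_Suc_imp)
    show "0 \<le> b x" for x using nn lt by (simp add: b_def)
    show "b x = 0" if "x \<notin> {0..1}" for x
    proof -
      have "x \<notin> {0<..<1}" using that by auto
      from z[OF this] show ?thesis by (simp add: b_def)
    qed
    show "B x = 0" if "x \<le> 0" for x using F0[OF that] by (simp add: B_def)
    show "B x = 1" if "x \<ge> 1" for x
      using F1[OF that] lt unfolding B_def by (simp add: divide_simps)
  qed (rule dB)
qed

text \<open>
  A smoothed indicator of \<open>[s, t]\<close>. Its derivative is the difference of two approximate unit masses, one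
  just to the right of \<open>s\<close> and one just to the right of \<open>t\<close>, so that testing a function against it
  compares averages near these points.
\<close>

lemma obtain_test_function_plateau:
  fixes s t \<epsilon> :: real
  assumes st: "0 < s" "s < t" and \<epsilon>: "0 < \<epsilon>"
  obtains \<phi> \<rho> \<sigma> where "test_function_on {0<..} \<phi>"
    "\<And>x. x \<notin> {s..t + \<epsilon>} \<Longrightarrow> \<phi> x = 0" "\<And>x. \<bar>\<phi> x\<bar> \<le> 1"
    "\<And>x. deriv \<phi> x = \<rho> x - \<sigma> x" "\<And>x. 0 \<le> \<rho> x" "\<And>x. 0 \<le> \<sigma> x"
    "\<And>x. x \<notin> {s..s + \<epsilon>} \<Longrightarrow> \<rho> x = 0" "\<And>x. x \<notin> {t..t + \<epsilon>} \<Longrightarrow> \<sigma> x = 0"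
    "(\<rho> has_integral 1) {s..t + \<epsilon>}" "(\<sigma> has_integral 1) {s..t + \<epsilon>}"
    "continuous_on UNIV (deriv \<phi>)"
proof -
  obtain B b where B: "\<And>n. diff_upto n B" "\<And>x. (B has_real_derivative b x) (at x)"
     "\<And>x. 0 \<le> b x" "\<And>x. x \<notin> {0..1} \<Longrightarrow> b x = 0"
     "\<And>x. x \<le> 0 \<Longrightarrow> B x = 0" "\<And>x. x \<ge> 1 \<Longrightarrow> B x = 1"
    using obtain_smooth_step by metis
  have mono: "B x \<le> B y" if "x \<le> y" for x y
    by (rule DERIV_nonneg_imp_nondecreasing[OF that]) (use B(2,3) in blast)
  have B0: "0 \<le> B x" for x using mono[of "min 0 x" x] B(5)[of "min 0 x"] by simp
  have B1: "B x \<le> 1" for x using mono[of x "max 1 x"] B(6)[of "max 1 x"] by simp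
  define S where "S r x = B (1 / \<epsilon> * x + (- r / \<epsilon>))" for r x
  define k where "k r x = 1 / \<epsilon> * b (1 / \<epsilon> * x + (- r / \<epsilon>))" for r x
  have arg: "1 / \<epsilon> * x + (- r / \<epsilon>) = (x - r) / \<epsilon>" for x r by (simp add: diff_divide_distrib)
  have dS: "(S r has_real_derivative k r x) (at x)" for r x
    unfolding S_def k_def
    by (rule DERIV_chain2[OF B(2), THEN DERIV_cong]) (use \<epsilon> in \<open>auto intro!: derivative_eq_intros\<close>)
  have k0: "k r x \<ge> 0" for r x using B(3) \<epsilon> by (simp add: k_def)
  have kz: "k r x = 0" if "x \<notin> {r..r + \<epsilon>}" for r x
    using that \<epsilon> B(4)[of "(x - r) / \<epsilon>"] unfolding k_def arg by (auto simp: field_simps)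
  have S0: "S r x = 0" if "x \<le> r" for r x
    using that \<epsilon> unfolding S_def arg by (intro B(5)) (simp add: divide_nonpos_pos)
  have S1: "S r x = 1" if "x \<ge> r + \<epsilon>" for r x
    using that \<epsilon> unfolding S_def arg by (intro B(6)) (simp add: field_simps)
  have kint: "(k r has_integral 1) {s..t + \<epsilon>}" if "s \<le> r" "r \<le> t" for r
  proof -
    have "(k r has_integral (S r (t + \<epsilon>) - S r s)) {s..t + \<epsilon>}"
      using st \<epsilon> dS by (intro fundamental_theorem_of_calculus)
        (auto simp flip: has_real_derivative_iff_has_vector_derivative intro: DERIV_subset)
    then show ?thesis using that S0[of s r] S1[of r "t + \<epsilon>"] by simp
  qed
  define \<phi> where "\<phi> x = S s x - S t x" for x
  have sm: "diff_upto n \<phi>" for n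
    using diff_upto_affine_comb[OF B(1) B(1), of n 1 "1 / \<epsilon>" "- s / \<epsilon>" "-1" "1 / \<epsilon>" "- t / \<epsilon>"]
    by (simp add: \<phi>_def[abs_def] S_def)
  have supp: "\<forall>x. x \<notin> {s..t + \<epsilon>} \<longrightarrow> \<phi> x = 0"
  proof (intro allI impI)
    fix x assume "x \<notin> {s..t + \<epsilon>}"
    then consider "x < s" | "x > t + \<epsilon>" by fastforce
    then show "\<phi> x = 0"
    proof cases
      case 1
      then show ?thesis using S0[of x s] S0[of x t] st by (simp add: \<phi>_def)
    next
      case 2
      then show ?thesis using S1[of s x] S1[of t x] st by (simp add: \<phi>_def)
    qed
  qed
  have d: "(\<phi> has_real_derivative k s x - k t x) (at x)" for x
    unfolding \<phi>_def by (intro derivative_intros dS)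
  have test: "test_function_on {0<..} \<phi>"
    unfolding test_function_on_def
  proof (intro conjI allI exI[of _ "{s..t + \<epsilon>}"])
    show "(deriv ^^ n) \<phi> differentiable at x" for n x
      using sm[of "Suc n"] by (simp add: diff_upto_def)
  qed (use st supp in auto)
  show ?thesis
  proof (rule that[of \<phi> "k s" "k t"])
    show "\<bar>\<phi> x\<bar> \<le> 1" for x
    proof -
      have "0 \<le> S s x" "S s x \<le> 1" "0 \<le> S t x" "S t x \<le> 1" by (simp_all only: S_def B0 B1)
      then show ?thesis unfolding \<phi>_def by linarith
    qed
    show "continuous_on UNIV (deriv \<phi>)"
    proof (rule DERIV_continuous_on)
      have "diff_upto (Suc (Suc 0)) \<phi>" by (rule sm)
      then show "(deriv \<phi> has_real_derivative deriv (deriv \<phi>) x) (at x)" for x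
        by (intro diff_upto_SucD)
    qed
    show "deriv \<phi> x = k s x - k t x" for x
      using d by (rule DERIV_imp_deriv)
    show "\<phi> x = 0" if "x \<notin> {s..t + \<epsilon>}" for x using supp that by blast
    show "k s x = 0" if "x \<notin> {s..s + \<epsilon>}" for x using that by (rule kz)
    show "k t x = 0" if "x \<notin> {t..t + \<epsilon>}" for x using that by (rule kz)
    show "(k s has_integral 1) {s..t + \<epsilon>}" "(k t has_integral 1) {s..t + \<epsilon>}"
      using st by (simp_all add: kint)
  qed (fact test k0)+
qed

section \<open>Boundedness from a weighted bound on the weak derivative\<close>

lemma set_lebesgue_integral_eq_integral_of_support:
  fixes f :: "real \<Rightarrow> real"
  assumes f: "f absolutely_integrable_on K" and "K \<subseteq> S" "\<And>x. x \<in> S - K \<Longrightarrow> f x = 0"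
  shows "(LINT x:S|lebesgue. f x) = integral K f"
proof -
  have "(LINT x:S|lebesgue. f x) = (LINT x:K|lebesgue. f x)"
    unfolding set_lebesgue_integral_def
    by (rule Bochner_Integration.integral_cong) (use assms(2,3) in \<open>auto simp: indicator_def\<close>)
  then show ?thesis using set_lebesgue_integral_eq_integral[OF f] by simp
qed

text \<open>
  A crude form of the fundamental theorem of calculus for weak derivatives. With a plateau test function
  \<open>\<phi>\<close>, the integral of \<open>u \<phi>'\<close> is an average of \<open>u\<close> near \<open>s\<close> minus an average near \<open>t\<close>, while the
  integral of \<open>g \<phi>\<close> is at most that of \<open>\<bar>g\<bar>\<close>. The summand \<open>2\<close> absorbs the error of replacing averages
  by point values, so that no limit of vanishing bump width is taken: boundedness of \<open>u\<close> is
  all that is wanted.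
\<close>

lemma oscillation_le_of_weak_derivative:
  fixes u g :: "real \<Rightarrow> real"
  assumes wd: "has_weak_derivative_on u g {0<..}" and cont: "continuous_on {0<..} u"
    and C: "\<And>a b. 0 < a \<Longrightarrow> a \<le> b \<Longrightarrow> integral {a..b} (\<lambda>x. \<bar>g x\<bar>) \<le> C"
    and st: "0 < s" "s < t"
  shows "\<bar>u t - u s\<bar> \<le> C + 2"
proof -
  have ct: "\<exists>d>0. \<forall>x. \<bar>x - r\<bar> < d \<longrightarrow> \<bar>u x - u r\<bar> < 1" if "r > 0" for r
  proof -
    have "isCont u r" using cont that by (simp add: continuous_on_eq_continuous_at)
    then show ?thesis unfolding continuous_at_eps_delta by (auto simp: dist_real_def)
  qed
  obtain d1 where d1: "d1 > 0" "\<And>x. \<bar>x - s\<bar> < d1 \<Longrightarrow> \<bar>u x - u s\<bar> < 1" using ct[of s] st by auto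
  obtain d2 where d2: "d2 > 0" "\<And>x. \<bar>x - t\<bar> < d2 \<Longrightarrow> \<bar>u x - u t\<bar> < 1" using ct[of t] st by auto
  define \<epsilon> where "\<epsilon> = min d1 d2 / 2"
  have \<epsilon>: "0 < \<epsilon>" "\<epsilon> < d1" "\<epsilon> < d2" using d1 d2 by (auto simp: \<epsilon>_def)
  let ?K = "{s..t + \<epsilon>}"
  have K: "compact ?K" "?K \<subseteq> {0<..}" using st by auto
  obtain \<phi> \<rho> \<sigma> where \<phi>: "test_function_on {0<..} \<phi>" "\<And>x. x \<notin> ?K \<Longrightarrow> \<phi> x = 0"
    "\<And>x. \<bar>\<phi> x\<bar> \<le> 1" "\<And>x. deriv \<phi> x = \<rho> x - \<sigma> x"
    "\<And>x. 0 \<le> \<rho> x" "\<And>x. 0 \<le> \<sigma> x"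
    "\<And>x. x \<notin> {s..s + \<epsilon>} \<Longrightarrow> \<rho> x = 0" "\<And>x. x \<notin> {t..t + \<epsilon>} \<Longrightarrow> \<sigma> x = 0"
    "(\<rho> has_integral 1) ?K" "(\<sigma> has_integral 1) ?K"
    "continuous_on UNIV (deriv \<phi>)"
    by (rule obtain_test_function_plateau[OF st \<epsilon>(1)]) (rule that; blast)
  have contu: "continuous_on ?K u" using cont K continuous_on_subset by blast
  have cont\<phi>: "continuous_on ?K \<phi>"
  proof (rule continuous_at_imp_continuous_on, intro ballI)
    fix x
    have "(deriv ^^ 0) \<phi> differentiable at x"
      using \<phi>(1) unfolding test_function_on_def by blast
    then show "isCont \<phi> x" by (simp add: differentiable_imp_continuous_within)
  qed
  have gK: "g absolutely_integrable_on ?K"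
    using wd K by (auto simp: has_weak_derivative_on_def locally_integrable_on_def)
  have u\<phi>: "(\<lambda>x. u x * deriv \<phi> x) absolutely_integrable_on ?K"
    by (intro absolutely_integrable_continuous_real continuous_intros contu)
       (use \<phi>(11) continuous_on_subset in blast)
  have g\<phi>: "(\<lambda>x. g x * \<phi> x) absolutely_integrable_on ?K"
  proof -
    have "bounded (\<phi> ` ?K)" using \<phi>(3) by (auto simp: bounded_iff)
    moreover have "\<phi> \<in> borel_measurable (lebesgue_on ?K)"
      using cont\<phi> by (intro continuous_imp_measurable_on_sets_lebesgue) auto
    ultimately have "(\<lambda>x. \<phi> x * g x) absolutely_integrable_on ?K"
      using gK by (intro absolutely_integrable_bounded_measurable_product_real) auto
    then show ?thesis by (simp add: mult.commute)
  qed
  have "(LINT x:{0<..}|lebesgue. u x * deriv \<phi> x) = integral ?K (\<lambda>x. u x * deriv \<phi> x)"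
  proof (rule set_lebesgue_integral_eq_integral_of_support[OF u\<phi> K(2)])
    fix x assume "x \<in> {0<..} - ?K"
    then have "\<rho> x = 0" "\<sigma> x = 0" using st \<epsilon> by (auto intro!: \<phi>(7,8))
    then show "u x * deriv \<phi> x = 0" by (simp add: \<phi>(4))
  qed
  moreover have "(LINT x:{0<..}|lebesgue. g x * \<phi> x) = integral ?K (\<lambda>x. g x * \<phi> x)"
    by (rule set_lebesgue_integral_eq_integral_of_support[OF g\<phi> K(2)]) (use \<phi>(2) in simp)
  ultimately have eq: "integral ?K (\<lambda>x. u x * deriv \<phi> x) = - integral ?K (\<lambda>x. g x * \<phi> x)"
    using wd \<phi>(1) by (simp add: has_weak_derivative_on_def)
  have "\<bar>integral ?K (\<lambda>x. g x * \<phi> x)\<bar> \<le> integral ?K (\<lambda>x. \<bar>g x\<bar>)"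
    unfolding real_norm_def[symmetric]
  proof (rule integral_norm_bound_integral)
    show "norm (g x * \<phi> x) \<le> norm (g x)" for x
      using mult_left_mono[OF \<phi>(3)[of x], of "\<bar>g x\<bar>"] by (simp add: abs_mult)
  qed (use g\<phi> gK in \<open>simp_all add: absolutely_integrable_on_def\<close>)
  also have "\<dots> \<le> C" using C[of s "t + \<epsilon>"] st \<epsilon> by simp
  finally have bound: "\<bar>integral ?K (\<lambda>x. u x * deriv \<phi> x)\<bar> \<le> C" using eq by simp
  have ui: "(\<lambda>x. u x * deriv \<phi> x) integrable_on ?K" using u\<phi> by (simp add: absolutely_integrable_on_def)
  have us: "(u s - 1) * \<rho> x \<le> u x * \<rho> x \<and> u x * \<rho> x \<le> (u s + 1) * \<rho> x" for x
  proof (cases "x \<in> {s..s+\<epsilon>}")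
    case True
    then have "\<bar>u x - u s\<bar> < 1" using \<epsilon> by (intro d1(2)) auto
    then have "u s - 1 \<le> u x" "u x \<le> u s + 1" by linarith+
    then show ?thesis by (intro conjI mult_right_mono \<phi>(5))
  qed (simp add: \<phi>(7))
  have ut: "(u t - 1) * \<sigma> x \<le> u x * \<sigma> x \<and> u x * \<sigma> x \<le> (u t + 1) * \<sigma> x" for x
  proof (cases "x \<in> {t..t+\<epsilon>}")
    case True
    then have "\<bar>u x - u t\<bar> < 1" using \<epsilon> by (intro d2(2)) auto
    then have "u t - 1 \<le> u x" "u x \<le> u t + 1" by linarith+
    then show ?thesis by (intro conjI mult_right_mono \<phi>(6))
  qed (simp add: \<phi>(8))
  have hi: "((\<lambda>x. c * \<rho> x - d * \<sigma> x) has_integral (c * 1 - d * 1)) ?K" for c d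
    by (intro has_integral_diff has_integral_mult_right \<phi>)
  have "(u s - 1) * 1 - (u t + 1) * 1 \<le> integral ?K (\<lambda>x. u x * deriv \<phi> x)"
    by (rule has_integral_le[OF hi integrable_integral[OF ui]])
       (unfold \<phi>(4) right_diff_distrib, intro diff_mono conjunct1[OF us] conjunct2[OF us] conjunct1[OF ut] conjunct2[OF ut])
  moreover have "integral ?K (\<lambda>x. u x * deriv \<phi> x) \<le> (u s + 1) * 1 - (u t - 1) * 1"
    by (rule has_integral_le[OF integrable_integral[OF ui] hi])
       (unfold \<phi>(4) right_diff_distrib, intro diff_mono conjunct1[OF us] conjunct2[OF us] conjunct1[OF ut] conjunct2[OF ut])
  ultimately show ?thesis using bound by (simp add: abs_le_iff)
qed

text \<open>
  With \<open>h t = (t + 1) sqrt t\<close> one has \<open>\<bar>g\<bar> \<le> h g\<^sup>2 + 1/h\<close>, and \<open>1/h\<close> has the bounded antiderivative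
  \<open>2 arctan (sqrt t)\<close>. So the weighted norm controls the integral of \<open>\<bar>g\<bar>\<close> over every compact interval
  uniformly, and with it the oscillation of \<open>u\<close>.
\<close>

lemma bounded_of_weighted_weak_derivative:
  fixes u g :: "real \<Rightarrow> real"
  assumes wd: "has_weak_derivative_on u g {0<..}" and cont: "continuous_on {0<..} u"
    and fin: "wL2_norm (\<lambda>_. 1) (\<lambda>t. sqrt ((t + 1) * sqrt t) * g t) < \<infinity>"
  shows "\<exists>M. \<forall>t>0. \<bar>u t\<bar> \<le> M"
proof -
  define h where "h t = (t + 1) * sqrt t" for t :: real
  define J where "J = (\<integral>\<^sup>+ t. ennreal ((sqrt (h t) * g t)\<^sup>2) \<partial>lebesgue_on {0..})"
  have J: "J < \<infinity>"
    using fin unfolding wL2_norm_def Let_def J_def h_def by (auto simp: top.not_eq_extremum split: if_splits)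
  have hpos: "h t > 0" if "t > 0" for t using that by (simp add: h_def)
  have "integral {a..b} (\<lambda>x. \<bar>g x\<bar>) \<le> enn2real J + pi" if ab: "0 < a" "a \<le> b" for a b
  proof -
    let ?K = "{a..b}"
    have "compact ?K" "?K \<subseteq> {0<..}" using ab by auto
    then have gK: "g absolutely_integrable_on ?K"
      using wd unfolding has_weak_derivative_on_def locally_integrable_on_def by blast
    then have gm: "(\<lambda>x. indicator ?K x * g x) \<in> borel_measurable lebesgue"
      by (auto simp: set_integrable_def)
    have "((\<lambda>x. \<bar>g x\<bar>) has_integral integral ?K (\<lambda>x. \<bar>g x\<bar>)) ?K"
      using gK by (intro integrable_integral) (simp add: absolutely_integrable_on_def)
    then have "ennreal (integral ?K (\<lambda>x. \<bar>g x\<bar>)) = (\<integral>\<^sup>+x. ennreal \<bar>g x\<bar> * indicator ?K x \<partial>lebesgue)"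
      by (subst nn_integral_completion, subst nn_integral_has_integral_lebesgue') auto
    also have "\<dots> \<le> (\<integral>\<^sup>+x. ennreal (h x * (indicator ?K x * g x)\<^sup>2) +
        ennreal (1 / h x) * indicator ?K x \<partial>lebesgue)"
    proof (rule nn_integral_mono)
      fix x
      show "ennreal \<bar>g x\<bar> * indicator ?K x \<le>
        ennreal (h x * (indicator ?K x * g x)\<^sup>2) + ennreal (1 / h x) * indicator ?K x"
      proof (cases "x \<in> ?K")
        case True
        then have h: "h x > 0" using hpos ab by simp
        have "2 * \<bar>g x\<bar> \<le> h x * (g x)\<^sup>2 + 1 / h x"
        proof -
          have "0 \<le> (h x * \<bar>g x\<bar> - 1)\<^sup>2 / h x" using h by simp
          also have "\<dots> = h x * (g x)\<^sup>2 + 1 / h x - 2 * \<bar>g x\<bar>"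
            using h by (simp add: power2_diff power_mult_distrib field_simps power2_eq_square)
          finally show ?thesis by simp
        qed
        then have "\<bar>g x\<bar> \<le> h x * (g x)\<^sup>2 + 1 / h x" by linarith
        then show ?thesis using True h by (simp flip: ennreal_plus add: ennreal_leI)
      qed simp
    qed
    also have "\<dots> = (\<integral>\<^sup>+x. ennreal (h x * (indicator ?K x * g x)\<^sup>2) \<partial>lebesgue) +
        (\<integral>\<^sup>+x. ennreal (1 / h x) * indicator ?K x \<partial>lebesgue)"
    proof (rule nn_integral_add)
      have hb [measurable]: "h \<in> borel_measurable borel" unfolding h_def[abs_def] by measurable
      then have hm: "h \<in> borel_measurable lebesgue" by (intro measurable_completion) simp
      show "(\<lambda>x. ennreal (h x * (indicator ?K x * g x)\<^sup>2)) \<in> borel_measurable lebesgue"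
        by (intro measurable_compose[OF _ measurable_ennreal] borel_measurable_times
            borel_measurable_power hm gm)
      show "(\<lambda>x. ennreal (1 / h x) * indicator ?K x) \<in> borel_measurable lebesgue"
        by (intro measurable_completion) measurable
    qed
    also have "(\<integral>\<^sup>+x. ennreal (h x * (indicator ?K x * g x)\<^sup>2) \<partial>lebesgue) \<le> J"
    proof -
      have "(\<integral>\<^sup>+x. ennreal (h x * (indicator ?K x * g x)\<^sup>2) \<partial>lebesgue)
        \<le> (\<integral>\<^sup>+ t. ennreal ((sqrt (h t) * g t)\<^sup>2) * indicator {0..} t \<partial>lebesgue)"
        using hpos ab by (intro nn_integral_mono)
          (auto simp: indicator_def power_mult_distrib real_sqrt_pow2 less_imp_le)
      then show ?thesis by (simp add: J_def nn_integral_restrict_space)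
    qed
    also have "(\<integral>\<^sup>+x. ennreal (1 / h x) * indicator ?K x \<partial>lebesgue) \<le> ennreal pi"
    proof -
      have "((\<lambda>x. 1 / h x) has_integral (2 * arctan (sqrt b) - 2 * arctan (sqrt a))) ?K"
      proof (rule fundamental_theorem_of_calculus[OF ab(2)])
        fix x assume "x \<in> ?K"
        then have x: "x > 0" using ab by simp
        have "((\<lambda>x. 2 * arctan (sqrt x)) has_real_derivative
            2 * (inverse (1 + (sqrt x)\<^sup>2) * (inverse (sqrt x) / 2))) (at x)"
          using x by (auto intro!: derivative_eq_intros)
        then have "((\<lambda>x. 2 * arctan (sqrt x)) has_real_derivative 1 / h x) (at x)"
          by (rule DERIV_cong) (use x in \<open>simp add: h_def inverse_eq_divide add.commute\<close>)
        then show "((\<lambda>x. 2 * arctan (sqrt x)) has_vector_derivative 1 / h x) (at x within ?K)"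
          by (simp add: has_real_derivative_iff_has_vector_derivative has_vector_derivative_at_within)
      qed
      then have "(\<integral>\<^sup>+x. ennreal (1 / h x) * indicator ?K x \<partial>lebesgue)
          = ennreal (2 * arctan (sqrt b) - 2 * arctan (sqrt a))"
      proof (subst nn_integral_completion, intro nn_integral_has_integral_lebesgue')
        show "0 \<le> 1 / h x" if "x \<in> ?K" for x
          using hpos[of x] ab that by simp
      qed
      also have "\<dots> \<le> ennreal pi"
      proof (rule ennreal_leI)
        have "0 \<le> arctan (sqrt a)" using ab by simp
        then show "2 * arctan (sqrt b) - 2 * arctan (sqrt a) \<le> pi"
          using arctan_ubound[of "sqrt b"] by linarith
      qed
      finally show ?thesis .
    qed
    finally have "ennreal (integral ?K (\<lambda>x. \<bar>g x\<bar>)) \<le> J + ennreal pi"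
      by (simp add: add_mono)
    also have "\<dots> = ennreal (enn2real J + pi)" using J by (simp add: less_top)
    finally show ?thesis
      by (subst (asm) ennreal_le_iff) (simp_all add: add_nonneg_nonneg)
  qed
  then have osc: "\<bar>u t - u s\<bar> \<le> enn2real J + pi + 2" if "0 < s" "s < t" for s t
    using oscillation_le_of_weak_derivative[OF wd cont _ that] by blast
  have "\<bar>u t\<bar> \<le> \<bar>u 1\<bar> + (enn2real J + pi + 2)" if "t > 0" for t
    using osc[of t 1] osc[of 1 t] that enn2real_nonneg[of J] pi_gt_zero
    by (cases t "1 :: real" rule: linorder_cases) auto
  then show ?thesis by blast
qed

section \<open>Gegenbauer polynomials\<close>

definition gegenbauer_functional :: "real \<Rightarrow> real poly \<Rightarrow> real" where
  "gegenbauer_functional \<alpha> p = (LINT x:{-1..1}|lborel. poly p x * gegenbauer_weight \<alpha> x)"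

text \<open>
  For \<open>\<alpha> \<ge> 0\<close> the weight is dominated by the Chebyshev weight, whose antiderivative \<open>arcsin\<close> is continuous up
  to the endpoints.
\<close>

lemma set_integrable_poly_gegenbauer_weight:
  assumes "\<alpha> \<ge> 0"
  shows "set_integrable lborel {-1..1} (\<lambda>x. poly p x * gegenbauer_weight \<alpha> x)"
proof -
  have "((\<lambda>x. 1 / sqrt (1 - x\<^sup>2)) has_integral (arcsin 1 - arcsin (-1))) {-1..1}"
  proof (rule fundamental_theorem_of_calculus_interior)
    show "continuous_on {-1..1} arcsin" by (intro continuous_on_arcsin continuous_on_id) auto
    fix x :: real assume "x \<in> {-1<..<1}"
    then have x: "-1 < x" "x < 1" by auto
    show "(arcsin has_vector_derivative 1 / sqrt (1 - x\<^sup>2)) (at x)"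
      using DERIV_arcsin[OF x]
      by (simp add: has_real_derivative_iff_has_vector_derivative inverse_eq_divide)
  qed simp
  then have "(\<lambda>x. 1 / sqrt (1 - x\<^sup>2)) absolutely_integrable_on {-1..1}"
    by (intro nonnegative_absolutely_integrable_1)
       (auto simp: integrable_on_def abs_square_le_1 abs_le_iff)
  then have chebyshev: "set_integrable lborel {-1..1} (\<lambda>x::real. 1 / sqrt (1 - x\<^sup>2))"
    unfolding set_integrable_def by (subst (asm) integrable_completion) auto
  have powr_le: "z powr (\<alpha> - 1/2) \<le> 1 / sqrt z" if z: "0 \<le> z" "z \<le> 1" for z :: real
  proof (cases "z = 0")
    case False
    then have "z powr (\<alpha> - 1/2) = z powr \<alpha> / sqrt z"
      using z by (simp add: powr_diff powr_half_sqrt)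
    also have "\<dots> \<le> 1 / sqrt z"
      using z assms by (intro divide_right_mono powr_le1) auto
    finally show ?thesis .
  qed simp
  obtain B where B: "\<And>x. x \<in> {-1..1} \<Longrightarrow> \<bar>poly p x\<bar> \<le> B"
  proof -
    have "compact (poly p ` {-1..1})" by (intro compact_continuous_image continuous_intros) auto
    then have "bounded (poly p ` {-1..1})" by (rule compact_imp_bounded)
    then obtain B where "\<forall>x \<in> {-1..1}. \<bar>poly p x\<bar> \<le> B"
      unfolding bounded_iff by auto
    then show ?thesis by (intro that[of B]) blast
  qed
  have "set_integrable lborel {-1..1} (\<lambda>x::real. B * (1 / sqrt (1 - x\<^sup>2)))"
    using chebyshev by (rule set_integrable_mult_right)
  then show ?thesis
  proof (rule set_integrable_bound)
    have "continuous_on UNIV (poly p)" by (intro continuous_intros)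
    then have [measurable]: "poly p \<in> borel_measurable borel" by (rule borel_measurable_continuous_onI)
    show "set_borel_measurable lborel {-1..1} (\<lambda>x. poly p x * gegenbauer_weight \<alpha> x)"
      unfolding set_borel_measurable_def gegenbauer_weight_def by measurable
    show "AE x in lborel. x \<in> {-1..1} \<longrightarrow> norm (poly p x * gegenbauer_weight \<alpha> x)
        \<le> norm (B * (1 / sqrt (1 - x\<^sup>2)))"
    proof (intro AE_I2 impI)
      fix x :: real assume x: "x \<in> {-1..1}"
      have y: "0 \<le> 1 - x\<^sup>2" "1 - x\<^sup>2 \<le> 1" using x by (auto simp: abs_square_le_1 abs_le_iff)
      have "gegenbauer_weight \<alpha> x \<le> 1 / sqrt (1 - x\<^sup>2)"
        unfolding gegenbauer_weight_def by (rule powr_le[OF y])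
      moreover have "gegenbauer_weight \<alpha> x \<ge> 0" by (simp add: gegenbauer_weight_def)
      ultimately have "\<bar>poly p x\<bar> * gegenbauer_weight \<alpha> x \<le> B * (1 / sqrt (1 - x\<^sup>2))"
        using B[OF x] y by (intro mult_mono) auto
      moreover have "B \<ge> 0" using B[OF x] by linarith
      ultimately show "norm (poly p x * gegenbauer_weight \<alpha> x) \<le> norm (B * (1 / sqrt (1 - x\<^sup>2)))"
        by (simp add: abs_mult gegenbauer_weight_def abs_of_nonneg[OF real_sqrt_ge_zero[OF y(1)]])
    qed
  qed
qed

lemma gegenbauer_functional_positive:
  assumes "\<alpha> \<ge> 0"
  shows "positive_functional (gegenbauer_functional \<alpha>) (-1) 1"
proof
  note int = set_integrable_poly_gegenbauer_weight[OF assms]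
  show "gegenbauer_functional \<alpha> (p + q) = gegenbauer_functional \<alpha> p + gegenbauer_functional \<alpha> q" for p q
    using int[of p] int[of q] by (simp add: gegenbauer_functional_def distrib_right set_integral_add)
  show "gegenbauer_functional \<alpha> (smult c p) = c * gegenbauer_functional \<alpha> p" for c p
    by (simp add: gegenbauer_functional_def mult.assoc)
  fix p :: "real poly"
  assume p: "p \<noteq> 0" and nn: "\<And>x. -1 < x \<Longrightarrow> x < 1 \<Longrightarrow> poly p x \<ge> 0"
  let ?f = "\<lambda>x. indicator {-1..1} x *\<^sub>R (poly p x * gegenbauer_weight \<alpha> x)"
  have fnn: "?f x \<ge> 0" for x
  proof (cases "x \<in> {-1<..<1}")
    case True
    then show ?thesis using nn by (simp add: gegenbauer_weight_def)
  next
    case False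
    then have "x \<notin> {-1..1} \<or> x = -1 \<or> x = 1" by auto
    then show ?thesis by (auto simp: gegenbauer_weight_def)
  qed
  have fi: "integrable lborel ?f" using int[of p] by (simp add: set_integrable_def)
  have "integral\<^sup>L lborel ?f \<noteq> 0"
  proof
    assume "integral\<^sup>L lborel ?f = 0"
    then have ae: "AE x in lborel. ?f x = 0"
      using integral_nonneg_eq_0_iff_AE[OF fi] fnn by simp
    have "finite {x. poly p x = 0}" using p by (simp add: poly_roots_finite)
    then have "AE x in lborel. x \<notin> {x. poly p x = 0}"
      by (intro AE_not_in finite_imp_null_set_lborel)
    with ae have "AE x in lborel. x \<notin> {-1<..<1::real}"
    proof eventually_elim
      case (elim x)
      then show ?case
        using abs_square_less_1[of x] by (auto simp: gegenbauer_weight_def indicator_def abs_less_iff split: if_splits)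
    qed
    then have "{-1<..<1::real} \<in> null_sets lborel" by (simp add: AE_iff_null_sets)
    then show False by (simp add: null_sets_def)
  qed
  moreover have "integral\<^sup>L lborel ?f \<ge> 0" using fnn by (intro integral_nonneg_AE) auto
  ultimately show "gegenbauer_functional \<alpha> p > 0"
    unfolding gegenbauer_functional_def set_lebesgue_integral_def by linarith
qed

text \<open>
  The defining description denotes something: existence is Gram-Schmidt, where all roots lie in the open
  interval and the normalisation at \<open>1\<close> therefore never divides by zero; uniqueness is that of
  orthogonal polynomials with a prescribed value at the endpoint.
\<close>

lemma gegenbauer_characterization:
  assumes "\<alpha> \<ge> 0"
  shows "degree (gegenbauer \<alpha> k) = k" "poly (gegenbauer \<alpha> k) 1 = 1"
    "positive_functional.orthogonal_below (gegenbauer_functional \<alpha>) k (gegenbauer \<alpha> k)"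
proof -
  interpret positive_functional "gegenbauer_functional \<alpha>" "-1" 1
    by (rule gegenbauer_functional_positive[OF assms])
  let ?Q = "\<lambda>G. (\<forall>k. degree (G k) = k \<and> poly (G k) 1 = 1) \<and>
     (\<forall>j k. j \<noteq> k \<longrightarrow>
        (LINT x:{-1..1}|lborel. poly (G j) x * poly (G k) x * gegenbauer_weight \<alpha> x) = 0)"
  have Q_iff: "?Q G \<longleftrightarrow> (\<forall>k. degree (G k) = k \<and> poly (G k) 1 = 1) \<and>
     (\<forall>j k. j \<noteq> k \<longrightarrow> gegenbauer_functional \<alpha> (G j * G k) = 0)" for G
    by (simp add: gegenbauer_functional_def)
  have orth: "orthogonal_below k (G k)" if "?Q G" for G k
  proof (rule orthogonal_belowI_sequence)
    show "degree (G k) = k \<and> G k \<noteq> 0" for k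
      using that by (metis poly_0 zero_neq_one)
  qed (use that Q_iff in blast)
  define P where "P k = (SOME P. orthogonal_below k P)" for k
  have P: "orthogonal_below k (P k)" for k
    unfolding P_def using ex_orthogonal_below by (rule someI_ex)
  have P1: "poly (P k) 1 \<noteq> 0" for k
    using orthogonal_below_roots(3)[OF P, of k] by auto
  define H where "H k = smult (1 / poly (P k) 1) (P k)" for k
  have "gegenbauer_functional \<alpha> (H j * H k) = 0" if "j \<noteq> k" for j k
  proof -
    have "gegenbauer_functional \<alpha> (P j * P k) = 0"
    proof (cases "k < j")
      case True
      then show ?thesis using P[of j] P[of k] by (simp add: orthogonal_below_def)
    next
      case False
      then have "gegenbauer_functional \<alpha> (P k * P j) = 0"
        using P[of j] P[of k] that by (simp add: orthogonal_below_def)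
      then show ?thesis by (simp add: mult.commute)
    qed
    then show ?thesis by (simp add: H_def E_smult)
  qed
  then have QH: "?Q H"
    unfolding Q_iff using P P1 by (auto simp: H_def orthogonal_below_def)
  have "?Q (gegenbauer \<alpha>)"
    unfolding gegenbauer_def
  proof (rule theI[of ?Q H, OF QH])
    fix G assume QG: "?Q G"
    show "G = H"
    proof
      fix k
      show "G k = H k"
        by (rule orthogonal_below_unique[OF orth[OF QG] orth[OF QH]]) (use QG QH in auto)
    qed
  qed
  then show "degree (gegenbauer \<alpha> k) = k" "poly (gegenbauer \<alpha> k) 1 = 1"
    "orthogonal_below k (gegenbauer \<alpha> k)"
    using orth by blast+
qed

section \<open>Transplantation to the half-line\<close>

lemma map_T_image:
  assumes "L > 0"
  shows "map_T i L ` {0<..} = {-1<..<1}"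
proof (intro set_eqI iffI)
  fix x assume "x \<in> map_T i L ` {0<..}"
  then show "x \<in> {-1<..<1}" using assms by (auto simp: map_T_def field_simps)
next
  fix x :: real assume x: "x \<in> {-1<..<1}"
  show "x \<in> map_T i L ` {0<..}"
  proof (cases "i = 1")
    case True
    have "x = map_T i L (L * (1 + x) / (1 - x))"
      using True x assms by (auto simp: map_T_def divide_simps) (auto simp: algebra_simps)
    then show ?thesis using x assms by (intro image_eqI[of _ _ "L * (1 + x) / (1 - x)"]) auto
  next
    case False
    have "x = map_T i L (- L * ln ((1 - x) / 2))"
      using False x assms by (simp add: map_T_def diff_divide_distrib)
    then show ?thesis using x assms
      by (intro image_eqI[of _ _ "- L * ln ((1 - x) / 2)"]) (auto simp: mult_pos_neg)
  qed
qed

lemma map_T_inj: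
  assumes "L > 0"
  shows "inj_on (map_T i L) {0..}"
  using assms by (auto intro!: inj_onI simp: map_T_def divide_simps split: if_splits)
    (auto simp: algebra_simps)

definition map_T_deriv :: "nat \<Rightarrow> real \<Rightarrow> real \<Rightarrow> real" where
  "map_T_deriv i L t = (if i = 1 then 2 * L / (t + L)\<^sup>2 else 2 / L * exp (- t / L))"

lemma DERIV_map_T:
  assumes "L > 0" "t > 0"
  shows "(map_T i L has_real_derivative map_T_deriv i L t) (at t)"
proof (cases "i = 1")
  case True
  have "((\<lambda>t. (t - L) / (t + L)) has_real_derivative 2 * L / (t + L)\<^sup>2) (at t)"
    using assms by (auto intro!: derivative_eq_intros simp: power2_eq_square divide_simps)
  then show ?thesis using True by (simp add: map_T_def[abs_def] map_T_deriv_def)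
next
  case False
  have "((\<lambda>t. 1 - 2 * exp (- t / L)) has_real_derivative 2 / L * exp (- t / L)) (at t)"
    using assms by (auto intro!: derivative_eq_intros simp: divide_simps)
  then show ?thesis using False by (simp add: map_T_def[abs_def] map_T_deriv_def)
qed

text \<open>
  The weights on the half-line are the pullbacks of the Gegenbauer weight, Jacobian included. This makes
  composition with the map an isometry of weighted spaces.
\<close>

lemma mapped_weight_eq:
  assumes "L > 0" "t > 0"
  shows "mapped_weight i \<alpha> L t = map_T_deriv i L t * gegenbauer_weight \<alpha> (map_T i L t)"
proof (cases "i = 1")
  case True
  have "1 - ((t - L) / (t + L))\<^sup>2 = ((t + L)\<^sup>2 - (t - L)\<^sup>2) / (t + L)\<^sup>2"
    using assms by (simp add: power_divide divide_simps)
  also have "\<dots> = 4 * L * t / (t + L) powr 2"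
    using assms by (simp add: powr_numeral) (simp add: power2_eq_square algebra_simps)
  finally have "gegenbauer_weight \<alpha> (map_T i L t) = (4 * L * t / (t + L) powr 2) powr (\<alpha> - 1/2)"
    using True by (simp add: gegenbauer_weight_def map_T_def)
  also have "\<dots> = 4 powr (\<alpha> - 1/2) * L powr (\<alpha> - 1/2) * t powr (\<alpha> - 1/2) / (t + L) powr (2 * \<alpha> - 1)"
    using assms by (simp add: powr_divide powr_mult powr_powr right_diff_distrib del: powr_numeral)
  finally have w: "gegenbauer_weight \<alpha> (map_T i L t) = \<dots>" .
  have "4 powr \<alpha> = 2 * 4 powr (\<alpha> - 1/2)"
    by (simp add: powr_diff powr_half_sqrt)
  moreover have "L powr (\<alpha> + 1/2) = L * L powr (\<alpha> - 1/2)"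
    using assms powr_add[of L 1 "\<alpha> - 1/2"] by (simp add: add.commute)
  moreover have "(t + L) powr (2 * \<alpha> + 1) = (t + L)\<^sup>2 * (t + L) powr (2 * \<alpha> - 1)"
    using assms powr_add[of "t + L" 2 "2 * \<alpha> - 1"] by (simp add: add.commute)
  ultimately show ?thesis using True w by (simp add: mapped_weight_def map_T_deriv_def)
next
  case False
  then show ?thesis by (simp add: mapped_weight_def map_T_deriv_def gegenbauer_weight_def map_T_def)
qed

lemma mapped_weight_pos:
  assumes "L > 0" "t > 0"
  shows "mapped_weight i \<alpha> L t > 0"
proof -
  have "map_T i L t \<in> {-1<..<1}" using map_T_image[OF assms(1)] assms(2) by blast
  then have "gegenbauer_weight \<alpha> (map_T i L t) > 0"
    using abs_square_less_1[of "map_T i L t"] by (simp add: gegenbauer_weight_def abs_less_iff)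
  moreover have "map_T_deriv i L t > 0" using assms by (simp add: map_T_deriv_def)
  ultimately show ?thesis by (simp add: mapped_weight_eq[OF assms])
qed

lemma wL2_norm_poly_map_T:
  assumes \<alpha>: "\<alpha> \<ge> 0" and L: "L > 0"
  shows "wL2_norm (mapped_weight i \<alpha> L) (\<lambda>t. poly p (map_T i L t))
    = ennreal (sqrt (gegenbauer_functional \<alpha> (p * p)))"
proof -
  let ?T = "map_T i L" and ?w = "mapped_weight i \<alpha> L"
  let ?f = "\<lambda>x. poly (p * p) x * gegenbauer_weight \<alpha> x"
  let ?I = "gegenbauer_functional \<alpha> (p * p)"
  have "set_integrable lborel {-1..1} ?f"
    by (rule set_integrable_poly_gegenbauer_weight[OF \<alpha>])
  then have ai: "?f absolutely_integrable_on {-1..1}"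
    unfolding set_integrable_def by (subst integrable_completion) auto
  have I: "integral {-1..1} ?f = ?I"
  proof -
    have "integral {-1..1} ?f = (LINT x:{-1..1}|lebesgue. ?f x)"
      using set_lebesgue_integral_eq_integral[OF ai] by simp
    also have "\<dots> = ?I"
      unfolding gegenbauer_functional_def set_lebesgue_integral_def
      using \<open>set_integrable lborel {-1..1} ?f\<close>
      by (intro integral_completion) (auto simp: set_integrable_def)
    finally show ?thesis .
  qed
  have "?f absolutely_integrable_on (?T ` {0<..}) \<and> integral (?T ` {0<..}) ?f = ?I"
    unfolding map_T_image[OF L]
  proof
    show "?f absolutely_integrable_on {-1<..<1}"
      using ai by (rule set_integrable_subset) auto
    show "integral {-1<..<1} ?f = ?I"
      using I unfolding integral_open_interval_real .
  qed
  moreover have "(?T has_real_derivative map_T_deriv i L t) (at t within {0<..})"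
    if "t \<in> {0<..}" for t
    by (rule has_field_derivative_at_within[OF DERIV_map_T[OF L]]) (use that in simp)
  moreover have "inj_on ?T {0<..}" by (rule inj_on_subset[OF map_T_inj[OF L]]) auto
  ultimately have cv: "(\<lambda>t. \<bar>map_T_deriv i L t\<bar> * ?f (?T t)) absolutely_integrable_on {0<..} \<and>
      integral {0<..} (\<lambda>t. \<bar>map_T_deriv i L t\<bar> * ?f (?T t)) = ?I"
    by (subst has_absolute_integral_change_of_variables_1'[where S = "{0<..}" and g = ?T
          and g' = "map_T_deriv i L" and f = ?f and b = ?I]) simp_all
  have eq: "\<bar>map_T_deriv i L t\<bar> * ?f (?T t) = \<bar>poly p (?T t)\<bar>\<^sup>2 * ?w t" if "t > 0" for t
    using L by (simp add: mapped_weight_eq[OF L that] power2_eq_square map_T_deriv_def)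
  have "((\<lambda>t. \<bar>poly p (?T t)\<bar>\<^sup>2 * ?w t) has_integral ?I) {0<..}"
  proof (rule has_integral_eq)
    show "((\<lambda>t. \<bar>map_T_deriv i L t\<bar> * ?f (?T t)) has_integral ?I) {0<..}"
      using cv by (metis absolutely_integrable_on_def integrable_integral)
  qed (use eq in auto)
  then have "(\<integral>\<^sup>+t. ennreal (\<bar>poly p (?T t)\<bar>\<^sup>2 * ?w t) * indicator {0<..} t \<partial>lebesgue) = ennreal ?I"
    by (subst nn_integral_completion, intro nn_integral_has_integral_lebesgue')
       (auto intro!: mult_nonneg_nonneg less_imp_le[OF mapped_weight_pos[OF L]])
  moreover have "(\<integral>\<^sup>+t. ennreal (\<bar>poly p (?T t)\<bar>\<^sup>2 * ?w t) \<partial>lebesgue_on {0..}) =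
     (\<integral>\<^sup>+t. ennreal (\<bar>poly p (?T t)\<bar>\<^sup>2 * ?w t) * indicator {0<..} t \<partial>lebesgue)"
  proof -
    \<comment> \<open>the weight need not be a pullback at \<open>t = 0\<close>, which is a null set\<close>
    have "AE t in lebesgue. t \<notin> {0::real}" by (rule AE_not_in) (simp add: null_sets_completionI)
    then show ?thesis
      by (subst nn_integral_restrict_space, simp, intro nn_integral_cong_AE)
         (auto elim!: eventually_mono simp: indicator_def)
  qed
  moreover have "?I \<ge> 0"
    using positive_functional.E_square_pos[OF gegenbauer_functional_positive[OF \<alpha>], of p]
      positive_functional.E_0[OF gegenbauer_functional_positive[OF \<alpha>]]
    by (cases "p = 0") (auto intro: less_imp_le)
  ultimately show ?thesis by (simp add: wL2_norm_def Let_def)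
qed

text \<open>
  The zeros of the Gegenbauer polynomial lie in \<open>(-1, 1)\<close>, the image of the open half-line, so each of them
  comes from exactly one node \<open>t > 0\<close>. Interpolation by the mapped functions is then Lagrange
  interpolation in the variable \<open>map_T i L t\<close>, and its uniqueness resolves the description.
\<close>

lemma interpolant_eq_poly:
  assumes \<alpha>: "\<alpha> \<ge> 0" and L: "L > 0"
  shows "\<exists>p. degree p < Suc n \<and> interpolant i \<alpha> L n u = (\<lambda>t. poly p (map_T i L t)) \<and>
    (\<forall>x. poly (gegenbauer \<alpha> (Suc n)) x = 0 \<longrightarrow> (\<exists>t>0. poly p x = u t))"
proof -
  interpret positive_functional "gegenbauer_functional \<alpha>" "-1" 1
    by (rule gegenbauer_functional_positive[OF \<alpha>])
  let ?T = "map_T i L"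
  define X where "X = {x. poly (gegenbauer \<alpha> (Suc n)) x = 0}"
  define \<tau> where "\<tau> = inv_into {0..} ?T"
  have X: "finite X" "card X = Suc n" "X \<subseteq> {-1<..<1}"
    using orthogonal_below_roots[OF gegenbauer_characterization(3)[OF \<alpha>, of "Suc n"]] by (auto simp: X_def)
  have \<tau>: "?T (\<tau> x) = x" "\<tau> x > 0" if "x \<in> X" for x
  proof -
    have "x \<in> ?T ` {0<..}" using map_T_image[OF L] X that by auto
    then obtain t where t: "t > 0" "x = ?T t" by auto
    then have "\<tau> x = t" unfolding \<tau>_def using map_T_inj[OF L] by (simp add: inv_into_f_f)
    with t show "?T (\<tau> x) = x" "\<tau> x > 0" by auto
  qed
  have nodes: "mapped_nodes i \<alpha> L n = \<tau> ` X" by (simp add: mapped_nodes_def X_def \<tau>_def)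
  have span: "v \<in> mapped_space i \<alpha> L n \<longleftrightarrow> (\<exists>p. degree p < Suc n \<and> v = (\<lambda>t. poly p (?T t)))" for v
  proof
    assume "v \<in> mapped_space i \<alpha> L n"
    then obtain a where "v = (\<lambda>t. \<Sum>k\<le>n. a k * mapped_gegenbauer i \<alpha> L k t)"
      by (auto simp: mapped_space_def)
    then have "v = (\<lambda>t. poly (\<Sum>k\<le>n. smult (a k) (gegenbauer \<alpha> k)) (?T t))"
      by (simp add: poly_sum mapped_gegenbauer_def)
    moreover have "degree (\<Sum>k\<le>n. smult (a k) (gegenbauer \<alpha> k)) \<le> n"
      by (intro degree_sum_le) (auto simp: gegenbauer_characterization[OF \<alpha>])
    ultimately show "\<exists>p. degree p < Suc n \<and> v = (\<lambda>t. poly p (?T t))" by (auto simp: less_Suc_eq_le)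
  next
    assume "\<exists>p. degree p < Suc n \<and> v = (\<lambda>t. poly p (?T t))"
    then obtain p where p: "degree p < Suc n" "v = (\<lambda>t. poly p (?T t))" by blast
    have "degree (gegenbauer \<alpha> k) = k \<and> gegenbauer \<alpha> k \<noteq> 0" for k
      using gegenbauer_characterization(1,2)[OF \<alpha>, of k] by auto
    then obtain a where "p = (\<Sum>k<Suc n. smult (a k) (gegenbauer \<alpha> k))"
      using poly_in_span_of_graded[of "Suc n" "gegenbauer \<alpha>" p] p(1) by blast
    then show "v \<in> mapped_space i \<alpha> L n"
      using p(2) by (auto simp: mapped_space_def poly_sum mapped_gegenbauer_def lessThan_Suc_atMost)
  qed
  define p where "p = (\<Sum>x\<in>X. smult (u (\<tau> x)) (lagrange_basis X x))"
  have p: "degree p < Suc n" "\<And>x. x \<in> X \<Longrightarrow> poly p x = u (\<tau> x)"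
    using degree_lagrange_interpolation[of X "\<lambda>x. u (\<tau> x)"] poly_lagrange_interpolation[of X] X
    by (cases "X = {}"; simp add: p_def)+
  have "interpolant i \<alpha> L n u = (\<lambda>t. poly p (?T t))"
    unfolding interpolant_def
  proof (rule the_equality)
    show "(\<lambda>t. poly p (?T t)) \<in> mapped_space i \<alpha> L n \<and>
        (\<forall>t\<in>mapped_nodes i \<alpha> L n. poly p (?T t) = u t)"
      using p \<tau> by (auto simp: span nodes)
  next
    fix v assume "v \<in> mapped_space i \<alpha> L n \<and> (\<forall>t\<in>mapped_nodes i \<alpha> L n. v t = u t)"
    then obtain q where q: "degree q < Suc n" "v = (\<lambda>t. poly q (?T t))"
      and "\<And>x. x \<in> X \<Longrightarrow> v (\<tau> x) = u (\<tau> x)"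
      by (auto simp: span nodes)
    then have "q = p"
      using p \<tau> X by (intro poly_eqI_on_nodes[of X]) auto
    then show "v = (\<lambda>t. poly p (?T t))" using q by simp
  qed
  then show ?thesis using p \<tau> by (intro exI[of _ p]) (auto simp: X_def)
qed

lemma wL2_norm_pos:
  assumes u: "u \<in> wL2 w" and w: "\<And>t. t > 0 \<Longrightarrow> w t > 0"
    and nz: "\<not> (AE t in lebesgue_on {0..}. u t = 0)"
    and wm: "w \<in> borel_measurable borel"
  shows "\<exists>N. N > 0 \<and> wL2_norm w u = ennreal N"
proof -
  let ?M = "lebesgue_on {0::real..}"
  define J where "J = (\<integral>\<^sup>+ t. ennreal (\<bar>u t\<bar>\<^sup>2 * w t) \<partial>?M)"
  have J: "J \<noteq> \<infinity>" "wL2_norm w u = ennreal (sqrt (enn2real J))"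
    using u by (auto simp: wL2_def wL2_norm_def Let_def J_def split: if_splits)
  have um: "u \<in> borel_measurable ?M" using u by (simp add: wL2_def)
  have wm': "w \<in> borel_measurable ?M"
    using wm by (intro measurable_restrict_space1 measurable_completion) simp
  have m: "(\<lambda>t. ennreal (\<bar>u t\<bar>\<^sup>2 * w t)) \<in> borel_measurable ?M"
    using um wm' by measurable
  have "J \<noteq> 0"
  proof
    assume "J = 0"
    then have "AE t in ?M. ennreal (\<bar>u t\<bar>\<^sup>2 * w t) = 0"
      unfolding J_def using nn_integral_0_iff_AE[OF m] by simp
    moreover have "AE t in ?M. t \<noteq> 0 \<and> t \<in> {0..}"
    proof -
      have "AE t in lebesgue. t \<notin> {0::real}" by (rule AE_not_in) (simp add: null_sets_completionI)
      then show ?thesis by (auto simp: AE_restrict_space_iff elim!: eventually_mono)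
    qed
    ultimately have "AE t in ?M. u t = 0"
    proof eventually_elim
      case (elim t)
      then have "w t > 0" using w by simp
      with elim show ?case by (auto simp: ennreal_eq_0_iff mult_le_0_iff)
    qed
    with nz show False by simp
  qed
  with J show ?thesis by (intro exI[of _ "sqrt (enn2real J)"]) (auto simp: enn2real_positive_iff less_top[symmetric] zero_less_iff_neq_zero)
qed

lemma measurable_mapped_weight: "mapped_weight i \<alpha> L \<in> borel_measurable borel"
  unfolding mapped_weight_def[abs_def] by measurable

section \<open>Boundedness of the interpolants\<close>

theorem theoremB2:
  fixes \<alpha> L :: real and i :: nat and u u' :: "real \<Rightarrow> real"
  assumes "\<alpha> \<ge> 0" and "L > 0" and "i \<in> {1, 2}"
    and "u \<in> wH1 (mapped_weight i \<alpha> L)"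
    and "continuous_on {0<..} u"
    and "has_weak_derivative_on u u' {0<..}"
    and "\<not> (AE t in lebesgue_on {0..}. u t = 0)"
  shows "\<exists>c::real. c > 0 \<and>
    (\<forall>\<^sub>F n in sequentially.
       wL2_norm (mapped_weight i \<alpha> L) (interpolant i \<alpha> L n u)
         < ennreal c * (wL2_norm (mapped_weight i \<alpha> L) u
             + ennreal (1 / real n) * wL2_norm (\<lambda>_. 1) (\<lambda>t. sqrt ((t + 1) * sqrt t) * u' t)))"
proof -
  interpret positive_functional "gegenbauer_functional \<alpha>" "-1" 1
    by (rule gegenbauer_functional_positive[OF assms(1)])
  let ?w = "mapped_weight i \<alpha> L"
  let ?D = "wL2_norm (\<lambda>_. 1) (\<lambda>t. sqrt ((t + 1) * sqrt t) * u' t)"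
  obtain N where N: "N > 0" "wL2_norm ?w u = ennreal N"
    using wL2_norm_pos[of u ?w] assms(4,7) mapped_weight_pos[OF assms(2)] measurable_mapped_weight
    by (auto simp: wH1_def)
  show ?thesis
  proof (cases "?D = \<infinity>")
    case True
    have "wL2_norm ?w (interpolant i \<alpha> L n u) < ennreal 1 * (wL2_norm ?w u + ennreal (1 / real n) * ?D)"
      if "n > 0" for n
    proof -
      obtain p where "interpolant i \<alpha> L n u = (\<lambda>t. poly p (map_T i L t))"
        using interpolant_eq_poly[OF assms(1,2)] by blast
      then have "wL2_norm ?w (interpolant i \<alpha> L n u) < \<infinity>"
        by (simp add: wL2_norm_poly_map_T[OF assms(1,2)])
      moreover have "ennreal (1 / real n) * ?D = \<infinity>"
        using that True by (simp add: ennreal_mult_top)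
      ultimately show ?thesis by simp
    qed
    then show ?thesis
      by (intro exI[of _ 1]) (auto intro: eventually_mono[OF eventually_gt_at_top[of 0]])
  next
    case False
    then obtain M where M: "\<And>t. t > 0 \<Longrightarrow> \<bar>u t\<bar> \<le> M"
      using bounded_of_weighted_weak_derivative[OF assms(6,5)] by (auto simp: top.not_eq_extremum)
    define B where "B = sqrt (M\<^sup>2 * gegenbauer_functional \<alpha> 1)"
    have "gegenbauer_functional \<alpha> 1 > 0" using E_square_pos[of 1] by simp
    then have B: "B \<ge> 0" by (simp add: B_def)
    \<comment> \<open>\<open>B\<close> bounds all interpolants; the summand \<open>1\<close> makes the final inequality strict\<close>
    define c where "c = (B + 1) / N"
    have "wL2_norm ?w (interpolant i \<alpha> L n u) < ennreal c * (wL2_norm ?w u + ennreal (1 / real n) * ?D)" for n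
    proof -
      obtain p where p: "degree p < Suc n" "interpolant i \<alpha> L n u = (\<lambda>t. poly p (map_T i L t))"
        "\<And>x. poly (gegenbauer \<alpha> (Suc n)) x = 0 \<Longrightarrow> \<exists>t>0. poly p x = u t"
        using interpolant_eq_poly[OF assms(1,2)] by blast
      have "gegenbauer_functional \<alpha> (p * p) \<le> M\<^sup>2 * gegenbauer_functional \<alpha> 1"
        using p(1) by (rule E_square_le_of_bounded_on_nodes[OF gegenbauer_characterization(3)[OF assms(1)]])
          (use M p(3) in metis)
      then have "wL2_norm ?w (interpolant i \<alpha> L n u) \<le> ennreal B"
        by (simp add: p(2) wL2_norm_poly_map_T[OF assms(1,2)] B_def ennreal_leI)
      also have "\<dots> < ennreal (B + 1)" using B by (simp add: ennreal_lessI)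
      also have "\<dots> = ennreal c * wL2_norm ?w u"
        using N B by (simp add: c_def flip: ennreal_mult)
      also have "\<dots> \<le> ennreal c * (wL2_norm ?w u + ennreal (1 / real n) * ?D)"
        by (intro mult_left_mono) auto
      finally show ?thesis .
    qed
    moreover have "c > 0" using N B by (simp add: c_def)
    ultimately show ?thesis by (intro exI[of _ c]) auto
  qed
qed

end
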